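(* The Edge Decomposition Algorithm (described in the context) runs in polynomial time, and whenever the input instance of the maximum revenue car dispatching problem satisfies the regularity condition, the flow $f$ returned by the algorithm achieves the maximum revenue of the car dispatching problem on the directed graph $(V_0,E_0)$; that is, $f$ is an optimal solution of the non-linearly weighted circulation problem on $(V_0,E_0)$.
   Context: **Instance.** Let $L$ be a finite set of locations and $T$ a finite set of discrete time slots (integers); states are $S=L\times T$. Travel from $l$ to $l'$ starting at time $t$ takes $\delta(l,l',t)\in\mathbb{Z}^+$ slots. For $s=(l,t)$, $s'=(l',t')$ the arc $(s,s')$ is *admissible* if $t'\ge t+\delta(l,l',t)$; $Q$ is the set of admissible arcs. Each $(s,s')\in Q$ has a known cost $c(s,s')$. For each $s\in S$, $n_s\in\mathbb{N}$ drivers start at $s$. There is a finite list of latent orders $(s_i,s_i',v_i)$ with $(s_i,s_i')\in Q$ and valuation $v_i$; all data are known. For $(s,s')\in Q$, $o(s,s')$ is the number of latent orders on $(s,s')$ and $v_k(s,s')$ is the $k$-th largest valuation among them. **Non-linearly weighted circulation (NLWC).** Given a directed (multi)graph $G=(V,E)$ where each edge $e$ has flow bounds $\ell(e)\le u(e)$ and a reward function $r(\cdot;e):\mathbb{N}\to\mathbb{R}$, find $f:E\to\mathbb{N}$ with $\ell(e)\le f(e)\le u(e)$ for all $e$ and flow conservation at every vertex, maximizing $\sum_{e} r(f(e);e)$. **The graph $(V_0,E_0)$.** $V_0=S\cup\{I,O\}$. Edges: $e_{O,I}$ from $O$ to $I$ with bounds $0,+\infty$ and zero reward; for each $s\in S$,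 $e_{I,s}$ from $I$ to $s$ with both bounds $n_s$ and zero reward; for each $s\in S$, $e_{s,O}$ from $s$ to $O$ with bounds $0,+\infty$ and zero reward; for each $(s,s')\in Q$, $e^{(\mathrm{o})}_{s,s'}$ from $s$ to $s'$ with bounds $0,+\infty$ and reward $-c(s,s')f$; for each $(s,s')\in Q$, $e^{(\mathrm{w})}_{s,s'}$ from $s$ to $s'$ with bounds $0,o(s,s')$ and reward $r(f;e^{(\mathrm{w})}_{s,s'})=[v_f(s,s')-c(s,s')]f$ (equal to $0$ for $f=0$). The maximum revenue car dispatching problem is NLWC on $(V_0,E_0)$. **Regularity condition.** For every $(s,s')\in Q$, the sequence $v'_k(s,s')$, $k=1,\dots,o(s,s')$, is monotonically non-increasing in $k$, where $v'_1(s,s')=v_1(s,s')$ and $v'_k(s,s')=k\,v_k(s,s')-(k-1)v_{k-1}(s,s')$ for $k\ge2$. **Edge Decomposition Algorithm.** 1. Construct the NLWC instance $(V_0,E_0,\ell,u,r)$. Let $E_1=\{e^{(\mathrm{w})}_{s,s'}\in E_0\}$ and $E_2=E_0\setminus E_1$. Build a linear-reward instance $(V_0,\tilde E,\tilde\ell,\tilde u,\tilde w)$ as follows. 2. For each $e^{(\mathrm{w})}_{s,s'}\in E_1$ and each $i\in\{1,\dots,o(s,s')\}$, add to $\tilde E$ an edge $e^{(\mathrm{w},i)}_{s,s'}$ from $s$ to $s'$ with $\tilde\ell=0$, $\tilde u=1$ and $\tilde w(e^{(\mathrm{w},i)}_{s,s'})=r(i;e^{(\mathrm{w})}_{s,s'})-r(i-1;e^{(\mathrm{w})}_{s,s'})$.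 3. Add each $e\in E_2$ to $\tilde E$ with $\tilde\ell(e)=\ell(e)$, $\tilde u(e)=u(e)$, and $\tilde w(e)=-c(s,s')$ if $e$ goes from $s$ to $s'$ with $s,s'\in S$, and $\tilde w(e)=0$ otherwise. 4. Compute, by a known polynomial-time algorithm (Tardos), an (integral) minimum cost circulation $\tilde f$ of $(V_0,\tilde E,\tilde\ell,\tilde u,-\tilde w)$, where $-\tilde w(e)$ is the linear cost per unit of flow on $e$. 5. Return $f:E_0\to\mathbb{N}$ with $f(e^{(\mathrm{w})}_{s,s'})=\sum_i\tilde f(e^{(\mathrm{w},i)}_{s,s'})$ for $e^{(\mathrm{w})}_{s,s'}\in E_1$ and $f(e)=\tilde f(e)$ for $e\in E_2$. *)

theory Defs
  imports
    Complex_Main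
    "HOL-Computational_Algebra.Polynomial"
    "HOL-Library.Extended_Nat"
    "HOL-Library.Log_Nat"
    "HOL-Library.Monad_Syntax"
    "Graph_Theory.Digraph"
begin

section \<open>Circulations\<close>

definition circulation ::
  "('v, 'e) pre_digraph \<Rightarrow> ('e \<Rightarrow> nat) \<Rightarrow> ('e \<Rightarrow> enat) \<Rightarrow> ('e \<Rightarrow> nat) \<Rightarrow> bool" where
  "circulation G l u f \<longleftrightarrow>
     (\<forall>e \<in> arcs G. l e \<le> f e \<and> enat (f e) \<le> u e) \<and>
     (\<forall>v \<in> verts G. (\<Sum>e \<in> in_arcs G v. f e) = (\<Sum>e \<in> out_arcs G v. f e))"

text \<open>Non-linearly weighted circulation; \<open>r k e\<close> is the reward \<open>r(k; e)\<close>.\<close>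

definition nlwc_optimal ::
  "('v, 'e) pre_digraph \<Rightarrow> ('e \<Rightarrow> nat) \<Rightarrow> ('e \<Rightarrow> enat) \<Rightarrow> (nat \<Rightarrow> 'e \<Rightarrow> real) \<Rightarrow> ('e \<Rightarrow> nat) \<Rightarrow> bool" where
  "nlwc_optimal G l u r f \<longleftrightarrow> circulation G l u f \<and>
     (\<forall>g. circulation G l u g \<longrightarrow> (\<Sum>e \<in> arcs G. r (g e) e) \<le> (\<Sum>e \<in> arcs G. r (f e) e))"

definition min_cost_circulation ::
  "('v, 'e) pre_digraph \<Rightarrow> ('e \<Rightarrow> nat) \<Rightarrow> ('e \<Rightarrow> enat) \<Rightarrow> ('e \<Rightarrow> real) \<Rightarrow> ('e \<Rightarrow> nat) \<Rightarrow> bool" where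
  "min_cost_circulation G l u w f \<longleftrightarrow> circulation G l u f \<and>
     (\<forall>g. circulation G l u g \<longrightarrow> (\<Sum>e \<in> arcs G. w e * real (f e)) \<le> (\<Sum>e \<in> arcs G. w e * real (g e)))"


section \<open>The car dispatching problem\<close>

type_synonym 'l state = "'l \<times> int"

text \<open>The finite sets of locations and slots are presented as duplicate-free lists. The
  function-valued fields are finite tables: only their entries at locations and slots of the
  instance (for \<open>cost\<close>: at admissible arcs) are used, and \<open>input_size\<close> counts all of these.\<close>

record 'l dispatch =
  locs :: "'l list"
  slots :: "int list"
  dur :: "'l \<Rightarrow> 'l \<Rightarrow> int \<Rightarrow> int"
  cost :: "'l state \<Rightarrow> 'l state \<Rightarrow> real"
  drivers :: "'l state \<Rightarrow> nat"
  orders :: "('l state \<times> 'l state \<times> real) list"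

definition states :: "'l dispatch \<Rightarrow> 'l state set" where
  "states X = set (locs X) \<times> set (slots X)"

definition reaches :: "'l dispatch \<Rightarrow> 'l state \<Rightarrow> 'l state \<Rightarrow> bool" where
  "reaches X s s' \<longleftrightarrow> snd s' \<ge> snd s + dur X (fst s) (fst s') (snd s)"

definition admissible :: "'l dispatch \<Rightarrow> ('l state \<times> 'l state) set" where
  "admissible X = {(s, s'). s \<in> states X \<and> s' \<in> states X \<and> reaches X s s'}"

definition valid_dispatch :: "'l dispatch \<Rightarrow> bool" where
  "valid_dispatch X \<longleftrightarrow> distinct (locs X) \<and> distinct (slots X) \<and>
     (\<forall>l \<in> set (locs X). \<forall>l' \<in> set (locs X). \<forall>t \<in> set (slots X). dur X l l' t > 0) \<and>
     (\<forall>(s, s', v) \<in> set (orders X). (s, s') \<in> admissible X)"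

definition valuations :: "'l dispatch \<Rightarrow> 'l state \<Rightarrow> 'l state \<Rightarrow> real list" where
  "valuations X s s' = map (\<lambda>(a, b, v). v) (filter (\<lambda>(a, b, v). a = s \<and> b = s') (orders X))"

definition num_orders :: "'l dispatch \<Rightarrow> 'l state \<Rightarrow> 'l state \<Rightarrow> nat" where
  "num_orders X s s' = length (valuations X s s')"

text \<open>The \<open>k\<close>-th largest valuation; meaningful for \<open>1 \<le> k \<le> num_orders X s s'\<close>.\<close>

definition kth_valuation :: "'l dispatch \<Rightarrow> 'l state \<Rightarrow> 'l state \<Rightarrow> nat \<Rightarrow> real" where
  "kth_valuation X s s' k = rev (sort (valuations X s s')) ! (k - 1)"

datatype 'l vertex = V_I | V_O | V_S "'l state"

datatype 'l edge =
    E_OI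
  | E_I "'l state"
  | E_O "'l state"
  | E_o "'l state" "'l state"
  | E_w "'l state" "'l state"

fun edge_tail :: "'l edge \<Rightarrow> 'l vertex" where
  "edge_tail E_OI = V_O"
| "edge_tail (E_I s) = V_I"
| "edge_tail (E_O s) = V_S s"
| "edge_tail (E_o s s') = V_S s"
| "edge_tail (E_w s s') = V_S s"

fun edge_head :: "'l edge \<Rightarrow> 'l vertex" where
  "edge_head E_OI = V_I"
| "edge_head (E_I s) = V_S s"
| "edge_head (E_O s) = V_O"
| "edge_head (E_o s s') = V_S s'"
| "edge_head (E_w s s') = V_S s'"

fun lower :: "'l dispatch \<Rightarrow> 'l edge \<Rightarrow> nat" where
  "lower X (E_I s) = drivers X s"
| "lower X _ = 0"

fun upper :: "'l dispatch \<Rightarrow> 'l edge \<Rightarrow> enat" where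
  "upper X (E_I s) = enat (drivers X s)"
| "upper X (E_w s s') = enat (num_orders X s s')"
| "upper X _ = \<infinity>"

fun reward :: "'l dispatch \<Rightarrow> nat \<Rightarrow> 'l edge \<Rightarrow> real" where
  "reward X k (E_o s s') = - cost X s s' * real k"
| "reward X k (E_w s s') = (if k = 0 then 0 else (kth_valuation X s s' k - cost X s s') * real k)"
| "reward X k _ = 0"

definition dispatch_graph :: "'l dispatch \<Rightarrow> ('l vertex, 'l edge) pre_digraph" where
  "dispatch_graph X =
    \<lparr> verts = {V_I, V_O} \<union> V_S ` states X,
      arcs = {E_OI} \<union> E_I ` states X \<union> E_O ` states X
        \<union> {E_o s s' | s s'. (s, s') \<in> admissible X}
        \<union> {E_w s s' | s s'. (s, s') \<in> admissible X},
      tail = edge_tail,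
      head = edge_head \<rparr>"

definition max_revenue_flow :: "'l dispatch \<Rightarrow> ('l edge \<Rightarrow> nat) \<Rightarrow> bool" where
  "max_revenue_flow X f \<longleftrightarrow>
     nlwc_optimal (dispatch_graph X) (lower X) (upper X) (reward X) f"

definition modified_valuation :: "'l dispatch \<Rightarrow> 'l state \<Rightarrow> 'l state \<Rightarrow> nat \<Rightarrow> real" where
  "modified_valuation X s s' k =
     (if k \<le> 1 then kth_valuation X s s' 1
      else real k * kth_valuation X s s' k - real (k - 1) * kth_valuation X s s' (k - 1))"

definition regular :: "'l dispatch \<Rightarrow> bool" where
  "regular X \<longleftrightarrow> (\<forall>(s, s') \<in> admissible X.
     antimono_on {1..num_orders X s s'} (modified_valuation X s s'))"


section \<open>Encoding lengths\<close>

definition nat_bits :: "nat \<Rightarrow> nat" where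
  "nat_bits n = Suc (floorlog 2 n)"

definition int_bits :: "int \<Rightarrow> nat" where
  "int_bits k = Suc (nat_bits (nat \<bar>k\<bar>))"

text \<open>Meaningful for rational numbers only: lengths of numerator and denominator in lowest terms.\<close>

definition real_bits :: "real \<Rightarrow> nat" where
  "real_bits x = (case quotient_of (the_inv real_of_rat x) of (p, q) \<Rightarrow> int_bits p + int_bits q)"

text \<open>A location is encoded by its position in \<open>locs\<close>.\<close>

definition state_bits :: "'l dispatch \<Rightarrow> 'l state \<Rightarrow> nat" where
  "state_bits X s = nat_bits (length (locs X)) + int_bits (snd s)"

definition input_size :: "'l dispatch \<Rightarrow> nat" where
  "input_size X =
     length (locs X) * nat_bits (length (locs X))
     + (\<Sum>t \<in> set (slots X). int_bits t)
     + (\<Sum>l \<in> set (locs X). \<Sum>l' \<in> set (locs X). \<Sum>t \<in> set (slots X). int_bits (dur X l l' t))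
     + (\<Sum>(s, s') \<in> admissible X. real_bits (cost X s s'))
     + (\<Sum>s \<in> states X. nat_bits (drivers X s))
     + (\<Sum>(s, s', v) \<leftarrow> orders X. state_bits X s + state_bits X s' + real_bits v)"

definition rational_dispatch :: "'l dispatch \<Rightarrow> bool" where
  "rational_dispatch X \<longleftrightarrow> (\<forall>(s, s') \<in> admissible X. cost X s s' \<in> \<rat>) \<and>
     (\<forall>(s, s', v) \<in> set (orders X). v \<in> \<rat>)"


section \<open>Computations with running time\<close>

text \<open>A computation is its result paired with the number of bit operations it takes. List cells
  are handled at unit cost; arithmetic is charged by the lengths of its operands.\<close>

type_synonym 'a timed = "'a \<times> nat"

definition charge :: "nat \<Rightarrow> 'a \<Rightarrow> 'a timed" where
  "charge n x = (x, n)"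

definition bind_timed :: "'a timed \<Rightarrow> ('a \<Rightarrow> 'b timed) \<Rightarrow> 'b timed" where
  "bind_timed m k = (fst (k (fst m)), snd m + snd (k (fst m)))"

adhoc_overloading Monad_Syntax.bind \<rightleftharpoons> bind_timed

text \<open>\<open>A\<close> runs in time polynomial in the length of its input, on all inputs satisfying \<open>P\<close>; the
  running time must at least cover the writing of the output.\<close>

definition polynomial_time ::
  "('a \<Rightarrow> bool) \<Rightarrow> ('a \<Rightarrow> nat) \<Rightarrow> ('b \<Rightarrow> nat) \<Rightarrow> ('a \<Rightarrow> 'b timed) \<Rightarrow> bool" where
  "polynomial_time P in_size out_size A \<longleftrightarrow> (\<exists>p :: nat poly. \<forall>x. P x \<longrightarrow>
     out_size (fst (A x)) \<le> snd (A x) \<and> snd (A x) \<le> poly p (in_size x))"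

fun map_timed :: "('a \<Rightarrow> 'b timed) \<Rightarrow> 'a list \<Rightarrow> 'b list timed" where
  "map_timed f [] = charge 1 []"
| "map_timed f (x # xs) = do { y \<leftarrow> f x; ys \<leftarrow> map_timed f xs; charge 1 (y # ys) }"

fun filter_timed :: "('a \<Rightarrow> bool timed) \<Rightarrow> 'a list \<Rightarrow> 'a list timed" where
  "filter_timed P [] = charge 1 []"
| "filter_timed P (x # xs) =
     do { b \<leftarrow> P x; ys \<leftarrow> filter_timed P xs; charge 1 (if b then x # ys else ys) }"

fun append_timed :: "'a list \<Rightarrow> 'a list \<Rightarrow> 'a list timed" where
  "append_timed [] ys = charge 1 ys"
| "append_timed (x # xs) ys = do { zs \<leftarrow> append_timed xs ys; charge 1 (x # zs) }"

fun concat_timed :: "'a list list \<Rightarrow> 'a list timed" where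
  "concat_timed [] = charge 1 []"
| "concat_timed (xs # xss) = do { ys \<leftarrow> concat_timed xss; append_timed xs ys }"

fun zip_timed :: "'a list \<Rightarrow> 'b list \<Rightarrow> ('a \<times> 'b) list timed" where
  "zip_timed (x # xs) (y # ys) = do { zs \<leftarrow> zip_timed xs ys; charge 1 ((x, y) # zs) }"
| "zip_timed _ _ = charge 1 []"

fun sum_timed :: "nat list \<Rightarrow> nat timed" where
  "sum_timed [] = charge 1 0"
| "sum_timed (x # xs) = do { n \<leftarrow> sum_timed xs; charge (nat_bits x + nat_bits n) (x + n) }"

text \<open>Schoolbook cost of one exact rational operation or comparison, including the reduction of
  the result to lowest terms.\<close>

definition arith :: "(real \<Rightarrow> real \<Rightarrow> 'a) \<Rightarrow> real \<Rightarrow> real \<Rightarrow> 'a timed" where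
  "arith f x y = charge ((real_bits x + real_bits y)\<^sup>2) (f x y)"

fun insert_desc :: "real \<Rightarrow> real list \<Rightarrow> real list timed" where
  "insert_desc x [] = charge 1 [x]"
| "insert_desc x (y # ys) =
     do { b \<leftarrow> arith (\<ge>) x y;
          if b then charge 1 (x # y # ys)
          else do { zs \<leftarrow> insert_desc x ys; charge 1 (y # zs) } }"

fun sort_desc :: "real list \<Rightarrow> real list timed" where
  "sort_desc [] = charge 1 []"
| "sort_desc (x # xs) = do { ys \<leftarrow> sort_desc xs; insert_desc x ys }"


section \<open>Linear circulation instances as inputs of an algorithm\<close>

record 'v lin_arc =
  arc_tail :: 'v
  arc_head :: 'v
  arc_lower :: nat
  arc_upper :: enat
  arc_cost :: real

type_synonym 'v network = "'v list \<times> 'v lin_arc list"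

definition valid_network :: "'v network \<Rightarrow> bool" where
  "valid_network N \<longleftrightarrow> distinct (fst N) \<and>
     (\<forall>a \<in> set (snd N). arc_tail a \<in> set (fst N) \<and> arc_head a \<in> set (fst N))"

definition rational_network :: "'v network \<Rightarrow> bool" where
  "rational_network N \<longleftrightarrow> (\<forall>a \<in> set (snd N). arc_cost a \<in> \<rat>)"

definition enat_bits :: "enat \<Rightarrow> nat" where
  "enat_bits u = (case u of enat k \<Rightarrow> nat_bits k | \<infinity> \<Rightarrow> 1)"

text \<open>A vertex is encoded by its position in the vertex list.\<close>

definition network_size :: "'v network \<Rightarrow> nat" where
  "network_size N = length (fst N) +
     (\<Sum>a \<leftarrow> snd N. 2 * nat_bits (length (fst N))
        + nat_bits (arc_lower a) + enat_bits (arc_upper a) + real_bits (arc_cost a))"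

text \<open>The edges of the multigraph are the positions in the arc list.\<close>

definition network_graph :: "'v network \<Rightarrow> ('v, nat) pre_digraph" where
  "network_graph N =
    \<lparr> verts = set (fst N), arcs = {..<length (snd N)},
      tail = (\<lambda>i. arc_tail (snd N ! i)), head = (\<lambda>i. arc_head (snd N ! i)) \<rparr>"

definition network_min_cost :: "'v network \<Rightarrow> (nat \<Rightarrow> nat) \<Rightarrow> bool" where
  "network_min_cost N = min_cost_circulation (network_graph N)
     (\<lambda>i. arc_lower (snd N ! i)) (\<lambda>i. arc_upper (snd N ! i)) (\<lambda>i. arc_cost (snd N ! i))"

definition solves_min_cost_circulation :: "('v network \<Rightarrow> nat list timed) \<Rightarrow> bool" where
  "solves_min_cost_circulation A \<longleftrightarrow>
     (\<forall>N. valid_network N \<and> (\<exists>f. network_min_cost N f) \<longrightarrow>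
        length (fst (A N)) = length (snd N) \<and> network_min_cost N (\<lambda>i. fst (A N) ! i))"

definition flow_list_size :: "nat list \<Rightarrow> nat" where
  "flow_list_size ks = (\<Sum>k \<leftarrow> ks. nat_bits k)"


section \<open>The Edge Decomposition Algorithm\<close>

text \<open>\<open>Unit s s' i\<close> is the edge \<open>e\<close> with superscript \<open>(w, i)\<close> from \<open>s\<close> to \<open>s'\<close>.\<close>

datatype 'l split_edge = Unit "'l state" "'l state" nat | Kept "'l edge"

fun origin :: "'l split_edge \<Rightarrow> 'l edge" where
  "origin (Unit s s' i) = E_w s s'"
| "origin (Kept e) = e"

fun kept_weight :: "'l dispatch \<Rightarrow> 'l edge \<Rightarrow> real" where
  "kept_weight X (E_o s s') = - cost X s s'"
| "kept_weight X _ = 0"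

text \<open>An elementary operation on boundedly many states and table entries of the input is charged
  as a scan of the whole input.\<close>

definition scan :: "'l dispatch \<Rightarrow> 'a \<Rightarrow> 'a timed" where
  "scan X x = charge (Suc (input_size X)) x"

definition list_states :: "'l dispatch \<Rightarrow> 'l state list timed" where
  "list_states X =
     do { rows \<leftarrow> map_timed (\<lambda>l. map_timed (\<lambda>t. scan X (l, t)) (slots X)) (locs X);
          concat_timed rows }"

definition list_admissible :: "'l dispatch \<Rightarrow> 'l state list \<Rightarrow> ('l state \<times> 'l state) list timed" where
  "list_admissible X ss =
     do { rows \<leftarrow> map_timed (\<lambda>s.
            do { ss' \<leftarrow> filter_timed (\<lambda>s'. scan X (reaches X s s')) ss;
                 map_timed (\<lambda>s'. scan X (s, s')) ss' }) ss;
          concat_timed rows }"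

definition sorted_valuations :: "'l dispatch \<Rightarrow> 'l state \<Rightarrow> 'l state \<Rightarrow> real list timed" where
  "sorted_valuations X s s' =
     do { os \<leftarrow> filter_timed (\<lambda>(a, b, v). scan X (a = s \<and> b = s')) (orders X);
          vs \<leftarrow> map_timed (\<lambda>(a, b, v). scan X v) os;
          sort_desc vs }"

text \<open>\<open>unit_arcs X s s' r i vs\<close> emits the edges \<open>(w, i), (w, i + 1), \<dots>\<close> of the arc \<open>(s, s')\<close>, where
  \<open>r\<close> is the reward at \<open>i - 1\<close> and \<open>vs\<close> are the \<open>i\<close>-th largest valuation and its successors. The
  network carries costs, hence the negated weights.\<close>

fun unit_arcs :: "'l dispatch \<Rightarrow> 'l state \<Rightarrow> 'l state \<Rightarrow> real \<Rightarrow> nat \<Rightarrow> real list \<Rightarrow>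
    ('l split_edge \<times> 'l vertex lin_arc) list timed" where
  "unit_arcs X s s' r i [] = charge 1 []"
| "unit_arcs X s s' r i (v # vs) =
     do { d \<leftarrow> arith (-) v (cost X s s');
          r' \<leftarrow> arith (*) d (real i);
          w \<leftarrow> arith (-) r' r;
          j \<leftarrow> charge (nat_bits i) (Suc i);
          a \<leftarrow> charge (real_bits w) \<lparr> arc_tail = V_S s, arc_head = V_S s', arc_lower = 0,
                 arc_upper = 1, arc_cost = - w \<rparr>;
          as \<leftarrow> unit_arcs X s s' r' j vs;
          scan X ((Unit s s' i, a) # as) }"

definition decomposed_arcs :: "'l dispatch \<Rightarrow> 'l state \<times> 'l state \<Rightarrow>
    ('l split_edge \<times> 'l vertex lin_arc) list timed" where
  "decomposed_arcs X q =
     do { vs \<leftarrow> sorted_valuations X (fst q) (snd q);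
          unit_arcs X (fst q) (snd q) 0 1 vs }"

definition kept_arc :: "'l dispatch \<Rightarrow> 'l edge \<Rightarrow> ('l split_edge \<times> 'l vertex lin_arc) timed" where
  "kept_arc X e =
     scan X (Kept e, \<lparr> arc_tail = edge_tail e, arc_head = edge_head e, arc_lower = lower X e,
       arc_upper = upper X e, arc_cost = - kept_weight X e \<rparr>)"

text \<open>The value on an edge \<open>e\<close> of the original graph is the sum of the flow over all edges
  originating from \<open>e\<close>; for \<open>e\<close> other than the \<open>E_w\<close> this is the flow on the single edge \<open>Kept e\<close>.\<close>

definition recombine :: "'l dispatch \<Rightarrow> ('l split_edge \<times> nat) list \<Rightarrow> 'l edge \<Rightarrow> ('l edge \<times> nat) timed" where
  "recombine X tab e =
     do { entries \<leftarrow> filter_timed (\<lambda>(e', k). scan X (origin e' = e)) tab;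
          ks \<leftarrow> map_timed (\<lambda>(e', k). charge (nat_bits k) k) entries;
          n \<leftarrow> sum_timed ks;
          charge (nat_bits n) (e, n) }"

definition edge_decomposition ::
  "('l vertex network \<Rightarrow> nat list timed) \<Rightarrow> 'l dispatch \<Rightarrow> ('l edge \<times> nat) list timed" where
  "edge_decomposition mcc X =
     do { ss \<leftarrow> list_states X;
          qs \<leftarrow> list_admissible X ss;
          eI \<leftarrow> map_timed (\<lambda>s. scan X (E_I s)) ss;
          eO \<leftarrow> map_timed (\<lambda>s. scan X (E_O s)) ss;
          eo \<leftarrow> map_timed (\<lambda>(s, s'). scan X (E_o s s')) qs;
          E1 \<leftarrow> map_timed (\<lambda>(s, s'). scan X (E_w s s')) qs;
          E2 \<leftarrow> concat_timed [[E_OI], eI, eO, eo];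
          unitss \<leftarrow> map_timed (decomposed_arcs X) qs;
          units \<leftarrow> concat_timed unitss;
          kept \<leftarrow> map_timed (kept_arc X) E2;
          split \<leftarrow> append_timed units kept;
          labels \<leftarrow> map_timed (\<lambda>a. charge 1 (fst a)) split;
          as \<leftarrow> map_timed (\<lambda>a. charge 1 (snd a)) split;
          vs \<leftarrow> map_timed (\<lambda>s. scan X (V_S s)) ss;
          ks \<leftarrow> mcc (V_I # V_O # vs, as);
          tab \<leftarrow> zip_timed labels ks;
          E0 \<leftarrow> append_timed E1 E2;
          map_timed (recombine X tab) E0 }"

text \<open>The flow described by a table; edges outside the table are irrelevant.\<close>

definition flow_of :: "('e \<times> nat) list \<Rightarrow> 'e \<Rightarrow> nat" where
  "flow_of tab e = (case map_of tab e of Some k \<Rightarrow> k | None \<Rightarrow> 0)"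

end

theory Submission
  imports Defs "HOL-Library.FuncSet"
begin

text \<open>
  Optimality rests on one observation: an edge with a concave reward is the same thing as a bundle of
  parallel unit edges that carry the increments of this reward. The increment of the reward of an
  order edge from \<open>i - 1\<close> to \<open>i\<close> units is \<open>v'\<^sub>i - c\<close> (\<open>marginal_reward_eq\<close>), so the regularity condition
  says exactly that these rewards are concave. Merging a circulation of the split network along
  \<open>origin\<close> gives a circulation of the dispatch graph with the same flow through every vertex. Its
  reward is at least the linear one, because \<open>k\<close> chosen increments never sum to more than the first
  \<open>k\<close> (\<open>sum_unit_selection_le_prefix\<close>). Conversely, filling the unit edges of each bundle in order turns
  a circulation of the dispatch graph into one of the split network, and then the increments telescope
  to the reward (\<open>greedy_split\<close>). Hence the merge of a cheapest circulation is an optimal one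
  (\<open>optimal_merge\<close>).

  The solver is only known to be correct on instances that have an optimum, so this must be shown for
  the split network. A feasible flow lets every driver leave at once. Flows are bounded although most
  edges are not: time strictly increases along every edge but the return edge \<open>E_OI\<close>, and the flow on
  that one is the number of drivers; weighting flow conservation with time as a potential bounds all
  other edges (\<open>dispatch_circulation_bounded\<close>). Costs of circulations therefore take finitely many values.

  For the running time, all lists that the algorithm handles have a length polynomial in the input
  size, and every number occurring in the construction is obtained from input numbers by a constant number
  of arithmetic operations, each of which increases the length of rational numbers only linearly
  (\<open>real_bits_diff\<close>, \<open>real_bits_mult\<close>). So the network handed to the solver has polynomial size, and
  its polynomial running time bounds both its share of the time and the length of the flow that
  remains to be recombined.
\<close>

section \<open>Merging parallel edges\<close>

lemma sum_over_fibres: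
  fixes f :: "'a \<Rightarrow> 'c::comm_monoid_add"
  assumes "finite A" "finite B" "\<phi> ` A \<subseteq> B"
  shows "(\<Sum>b\<in>B. \<Sum>a | a \<in> A \<and> \<phi> a = b. f a) = (\<Sum>a\<in>A. f a)"
  using sum.group[OF assms, of f] by simp

text \<open>The digraph \<open>H\<close> arises from \<open>G\<close> by replacing each edge \<open>e\<close> by a (possibly empty) bundle of parallel
  edges, the fibre of \<open>\<phi>\<close> over \<open>e\<close>.\<close>

locale parallel_refinement =
  fixes G :: "('v, 'e) pre_digraph" and H :: "('v, 'x) pre_digraph" and \<phi> :: "'x \<Rightarrow> 'e"
  assumes finite_G: "finite (arcs G)" and finite_H: "finite (arcs H)"
    and verts_H: "verts H = verts G"
    and origin_arc: "x \<in> arcs H \<Longrightarrow> \<phi> x \<in> arcs G"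
    and tail_H: "x \<in> arcs H \<Longrightarrow> tail H x = tail G (\<phi> x)"
    and head_H: "x \<in> arcs H \<Longrightarrow> head H x = head G (\<phi> x)"
begin

definition fibre :: "'e \<Rightarrow> 'x set" where
  "fibre e = {x \<in> arcs H. \<phi> x = e}"

definition merge :: "('x \<Rightarrow> nat) \<Rightarrow> 'e \<Rightarrow> nat" where
  "merge g e = (\<Sum>x\<in>fibre e. g x)"

lemma sum_fibres:
  fixes f :: "'x \<Rightarrow> 'c::comm_monoid_add"
  shows "(\<Sum>e\<in>arcs G. \<Sum>x\<in>fibre e. f x) = (\<Sum>x\<in>arcs H. f x)"
  unfolding fibre_def
  by (rule sum_over_fibres) (use finite_G finite_H origin_arc in auto)

lemma sum_in_arcs_merge: "(\<Sum>e\<in>in_arcs G v. merge g e) = (\<Sum>x\<in>in_arcs H v. g x)"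
proof -
  have "merge g e = (\<Sum>x | x \<in> in_arcs H v \<and> \<phi> x = e. g x)" if "e \<in> in_arcs G v" for e
    unfolding merge_def by (rule sum.cong) (use that head_H in \<open>auto simp: fibre_def\<close>)
  then have "(\<Sum>e\<in>in_arcs G v. merge g e)
      = (\<Sum>e\<in>in_arcs G v. \<Sum>x | x \<in> in_arcs H v \<and> \<phi> x = e. g x)"
    by simp
  also have "\<dots> = (\<Sum>x\<in>in_arcs H v. g x)"
    by (rule sum_over_fibres)
      (use finite_G finite_H origin_arc head_H in \<open>auto simp: in_arcs_def\<close>)
  finally show ?thesis .
qed

lemma sum_out_arcs_merge: "(\<Sum>e\<in>out_arcs G v. merge g e) = (\<Sum>x\<in>out_arcs H v. g x)"
proof -
  have "merge g e = (\<Sum>x | x \<in> out_arcs H v \<and> \<phi> x = e. g x)" if "e \<in> out_arcs G v" for e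
    unfolding merge_def by (rule sum.cong) (use that tail_H in \<open>auto simp: fibre_def\<close>)
  then have "(\<Sum>e\<in>out_arcs G v. merge g e)
      = (\<Sum>e\<in>out_arcs G v. \<Sum>x | x \<in> out_arcs H v \<and> \<phi> x = e. g x)"
    by simp
  also have "\<dots> = (\<Sum>x\<in>out_arcs H v. g x)"
    by (rule sum_over_fibres)
      (use finite_G finite_H origin_arc tail_H in \<open>auto simp: out_arcs_def\<close>)
  finally show ?thesis .
qed

lemma circulation_merge:
  assumes "circulation H l' u' g"
    and bounds: "\<And>e g. e \<in> arcs G \<Longrightarrow> \<forall>x\<in>fibre e. l' x \<le> g x \<and> enat (g x) \<le> u' x
      \<Longrightarrow> l e \<le> merge g e \<and> enat (merge g e) \<le> u e"
  shows "circulation G l u (merge g)"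
  using assms unfolding circulation_def sum_in_arcs_merge sum_out_arcs_merge verts_H
  by (auto simp: fibre_def)

lemma circulation_split:
  assumes circ: "circulation G l u f"
    and distribute: "\<And>e. e \<in> arcs G \<Longrightarrow> merge g e = f e
      \<and> (\<forall>x\<in>fibre e. l' x \<le> g x \<and> enat (g x) \<le> u' x)"
  shows "circulation H l' u' g"
proof -
  have "(\<Sum>e\<in>in_arcs G v. f e) = (\<Sum>x\<in>in_arcs H v. g x)"
    "(\<Sum>e\<in>out_arcs G v. f e) = (\<Sum>x\<in>out_arcs H v. g x)" for v
    unfolding sum_in_arcs_merge[symmetric] sum_out_arcs_merge[symmetric]
    by (intro sum.cong; use distribute in simp)+
  moreover have "l' x \<le> g x \<and> enat (g x) \<le> u' x" if "x \<in> arcs H" for x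
    using distribute[OF origin_arc[OF that]] that by (auto simp: fibre_def)
  ultimately show ?thesis
    using circ by (simp add: circulation_def verts_H)
qed

text \<open>Costs on \<open>H\<close> are negated rewards. The linear reward of a flow on a bundle must not exceed the reward
  of its total on the merged edge (\<open>concave\<close>), and every admitted total must have a distribution over
  the bundle for which the two agree (\<open>attained\<close>). Then the optimal values coincide: the reward of a
  flow \<open>f\<close> of \<open>G\<close> is the linear one of \<open>split f\<close>, which is at most that of \<open>g\<close>, hence at most the
  reward of \<open>merge g\<close>.\<close>

lemma optimal_merge:
  assumes opt: "min_cost_circulation H l' u' w g"
    and merge_bounds: "\<And>e g. e \<in> arcs G \<Longrightarrow> \<forall>x\<in>fibre e. l' x \<le> g x \<and> enat (g x) \<le> u' x
      \<Longrightarrow> l e \<le> merge g e \<and> enat (merge g e) \<le> u e"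
    and concave: "\<And>e g. e \<in> arcs G \<Longrightarrow> \<forall>x\<in>fibre e. l' x \<le> g x \<and> enat (g x) \<le> u' x
      \<Longrightarrow> (\<Sum>x\<in>fibre e. - w x * real (g x)) \<le> r (merge g e) e"
    and attained: "\<And>f e. e \<in> arcs G \<Longrightarrow> l e \<le> f e \<Longrightarrow> enat (f e) \<le> u e
      \<Longrightarrow> merge (split f) e = f e
        \<and> (\<forall>x\<in>fibre e. l' x \<le> split f x \<and> enat (split f x) \<le> u' x)
        \<and> (\<Sum>x\<in>fibre e. - w x * real (split f x)) = r (f e) e"
  shows "nlwc_optimal G l u r (merge g)"
  unfolding nlwc_optimal_def
proof (intro conjI allI impI)
  have g: "circulation H l' u' g"
    using opt by (simp add: min_cost_circulation_def)
  show "circulation G l u (merge g)"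
    by (rule circulation_merge[OF g merge_bounds])
  fix f assume f: "circulation G l u f"
  then have f_bounds: "l e \<le> f e" "enat (f e) \<le> u e" if "e \<in> arcs G" for e
    using that by (auto simp: circulation_def)
  have "circulation H l' u' (split f)"
    by (rule circulation_split[OF f]) (use attained f_bounds in blast)
  then have cheaper: "(\<Sum>x\<in>arcs H. w x * real (g x)) \<le> (\<Sum>x\<in>arcs H. w x * real (split f x))"
    using opt by (simp add: min_cost_circulation_def)
  have "(\<Sum>e\<in>arcs G. r (f e) e) = (\<Sum>e\<in>arcs G. \<Sum>x\<in>fibre e. - w x * real (split f x))"
    by (intro sum.cong) (use attained f_bounds in auto)
  also have "\<dots> = (\<Sum>x\<in>arcs H. - w x * real (split f x))"
    by (rule sum_fibres)
  also have "\<dots> \<le> (\<Sum>x\<in>arcs H. - w x * real (g x))"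
    using cheaper by (simp add: sum_negf)
  also have "\<dots> = (\<Sum>e\<in>arcs G. \<Sum>x\<in>fibre e. - w x * real (g x))"
    by (rule sum_fibres[symmetric])
  also have "\<dots> \<le> (\<Sum>e\<in>arcs G. r (merge g e) e)"
    using g by (intro sum_mono concave) (auto simp: circulation_def fibre_def)
  finally show "(\<Sum>e\<in>arcs G. r (f e) e) \<le> (\<Sum>e\<in>arcs G. r (merge g e) e)" .
qed

end

text \<open>This is where concavity enters: if a selection of weights includes the last one, which is the
  smallest, then exchanging it for the first weight not yet in the prefix cannot decrease the sum.\<close>

lemma sum_unit_selection_le_prefix:
  fixes w :: "nat \<Rightarrow> real"
  assumes "antimono_on {1..n} w" "\<forall>i\<in>{1..n}. y i \<le> (1::nat)"
  shows "(\<Sum>i=1..n. w i * real (y i)) \<le> (\<Sum>i=1..(\<Sum>i=1..n. y i). w i)"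
  using assms
proof (induction n)
  case 0
  then show ?case by simp
next
  case (Suc n)
  let ?k = "\<Sum>i=1..n. y i"
  have k: "?k \<le> n"
    using sum_bounded_above[of "{1..n}" y 1] Suc.prems(2) by simp
  have IH: "(\<Sum>i=1..n. w i * real (y i)) \<le> (\<Sum>i=1..?k. w i)"
    using Suc.prems by (intro Suc.IH) (auto simp: monotone_on_def)
  have "y (Suc n) \<le> 1"
    using Suc.prems(2) by simp
  then consider "y (Suc n) = 0" | "y (Suc n) = 1" by linarith
  then show ?case
  proof cases
    case 1
    then show ?thesis using IH by simp
  next
    case 2
    have "w (Suc n) \<le> w (Suc ?k)"
      using Suc.prems(1) k by (auto simp: monotone_on_def)
    then show ?thesis using IH 2 by simp
  qed
qed

section \<open>Existence of minimum cost circulations\<close>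

text \<open>The cost depends only on the values on the arcs, so boundedness leaves finitely many costs even
  though circulations are arbitrary outside the arcs.\<close>

lemma min_cost_circulation_exists:
  assumes fin: "finite (arcs G)" and ex: "circulation G l u f0"
    and bounded: "\<And>f e. circulation G l u f \<Longrightarrow> e \<in> arcs G \<Longrightarrow> f e \<le> B"
  shows "\<exists>f. min_cost_circulation G l u w f"
proof -
  define c where "c f = (\<Sum>e\<in>arcs G. w e * real (f e))" for f
  let ?C = "{f. circulation G l u f}"
  have "c ` ?C \<subseteq> c ` (arcs G \<rightarrow>\<^sub>E {..B})"
  proof
    fix k assume "k \<in> c ` ?C"
    then obtain f where f: "circulation G l u f" "k = c f" by auto
    then have "k = c (restrict f (arcs G))" "restrict f (arcs G) \<in> arcs G \<rightarrow>\<^sub>E {..B}"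
      using bounded by (auto simp: c_def)
    then show "k \<in> c ` (arcs G \<rightarrow>\<^sub>E {..B})" by blast
  qed
  moreover have "finite (arcs G \<rightarrow>\<^sub>E {..B})"
    using fin by (intro finite_PiE) auto
  ultimately have finC: "finite (c ` ?C)"
    by (meson finite_imageI finite_subset)
  moreover have "c ` ?C \<noteq> {}" using ex by auto
  ultimately have "Min (c ` ?C) \<in> c ` ?C" by (rule Min_in)
  then obtain f where "circulation G l u f" "c f = Min (c ` ?C)" by auto
  then show ?thesis
    using finC by (auto simp: min_cost_circulation_def c_def intro!: exI[of _ f] Min_le)
qed

text \<open>Flow conservation at \<open>v\<close>, weighted with \<open>\<pi> v\<close> and summed over all vertices: each edge is counted
  once at its head and once at its tail.\<close>

lemma circulation_potential:
  fixes \<pi> :: "'v \<Rightarrow> int"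
  assumes fin: "finite (arcs G)" "finite (verts G)"
    and ends: "\<And>e. e \<in> arcs G \<Longrightarrow> tail G e \<in> verts G \<and> head G e \<in> verts G"
    and circ: "circulation G l u f"
  shows "(\<Sum>e\<in>arcs G. int (f e) * (\<pi> (head G e) - \<pi> (tail G e))) = 0"
proof -
  have "(\<Sum>e\<in>arcs G. int (f e) * \<pi> (head G e))
      = (\<Sum>v\<in>verts G. \<Sum>e | e \<in> arcs G \<and> head G e = v. int (f e) * \<pi> (head G e))"
    by (rule sum_over_fibres[symmetric]) (use fin ends in auto)
  also have "\<dots> = (\<Sum>v\<in>verts G. \<pi> v * int (\<Sum>e\<in>in_arcs G v. f e))"
    by (auto simp: in_arcs_def sum_distrib_left mult.commute intro!: sum.cong)
  also have "\<dots> = (\<Sum>v\<in>verts G. \<pi> v * int (\<Sum>e\<in>out_arcs G v. f e))"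
    using circ by (simp add: circulation_def)
  also have "\<dots> = (\<Sum>v\<in>verts G. \<Sum>e | e \<in> arcs G \<and> tail G e = v. int (f e) * \<pi> (tail G e))"
    by (auto simp: out_arcs_def sum_distrib_left mult.commute intro!: sum.cong)
  also have "\<dots> = (\<Sum>e\<in>arcs G. int (f e) * \<pi> (tail G e))"
    by (rule sum_over_fibres) (use fin ends in auto)
  finally show ?thesis
    by (simp add: right_diff_distrib sum_subtractf)
qed

section \<open>Feasible flows of the dispatch graph\<close>

lemma finite_states [simp]: "finite (states X)"
  by (simp add: states_def)

lemma finite_admissible [simp]: "finite (admissible X)"
  by (rule finite_subset[of _ "states X \<times> states X"]) (auto simp: admissible_def)

lemma dispatch_graph_simps [simp]:
  "verts (dispatch_graph X) = {V_I, V_O} \<union> V_S ` states X"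
  "tail (dispatch_graph X) = edge_tail" "head (dispatch_graph X) = edge_head"
  by (simp_all add: dispatch_graph_def)

lemma arcs_dispatch_graph:
  "arcs (dispatch_graph X) = {E_OI} \<union> E_I ` states X \<union> E_O ` states X
     \<union> case_prod E_o ` admissible X \<union> case_prod E_w ` admissible X"
  by (auto simp: dispatch_graph_def image_def)

lemma finite_arcs_dispatch_graph [simp]: "finite (arcs (dispatch_graph X))"
  by (simp add: arcs_dispatch_graph)

text \<open>No driver ever travels: everyone passes from \<open>V_I\<close> through the start state directly to \<open>V_O\<close>.\<close>

fun idle_flow :: "'l dispatch \<Rightarrow> 'l edge \<Rightarrow> nat" where
  "idle_flow X E_OI = (\<Sum>s\<in>states X. drivers X s)"
| "idle_flow X (E_I s) = drivers X s"
| "idle_flow X (E_O s) = drivers X s"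
| "idle_flow X _ = 0"

lemma in_arcs_I: "in_arcs (dispatch_graph X) V_I = {E_OI}"
  and out_arcs_I: "out_arcs (dispatch_graph X) V_I = E_I ` states X"
  and in_arcs_O: "in_arcs (dispatch_graph X) V_O = E_O ` states X"
  and out_arcs_O: "out_arcs (dispatch_graph X) V_O = {E_OI}"
  by (auto simp: in_arcs_def out_arcs_def arcs_dispatch_graph)

lemma circulation_idle_flow: "circulation (dispatch_graph X) (lower X) (upper X) (idle_flow X)"
  unfolding circulation_def
proof (intro conjI ballI)
  fix e assume "e \<in> arcs (dispatch_graph X)"
  show "lower X e \<le> idle_flow X e" "enat (idle_flow X e) \<le> upper X e"
    by (cases e; simp add: zero_enat_def[symmetric])+
next
  fix v assume "v \<in> verts (dispatch_graph X)"
  then consider "v = V_I" | "v = V_O" | s where "v = V_S s" "s \<in> states X" by auto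
  then show "sum (idle_flow X) (in_arcs (dispatch_graph X) v)
      = sum (idle_flow X) (out_arcs (dispatch_graph X) v)"
  proof cases
    case 3
    have "sum (idle_flow X) (in_arcs (dispatch_graph X) v) = sum (idle_flow X) {E_I s}"
      by (rule sum.mono_neutral_right) (use 3 in \<open>auto simp: in_arcs_def arcs_dispatch_graph\<close>)
    moreover have "sum (idle_flow X) (out_arcs (dispatch_graph X) v) = sum (idle_flow X) {E_O s}"
      by (rule sum.mono_neutral_right) (use 3 in \<open>auto simp: out_arcs_def arcs_dispatch_graph\<close>)
    ultimately show ?thesis by simp
  qed (simp_all add: in_arcs_I out_arcs_I in_arcs_O out_arcs_O sum.reindex inj_on_def)
qed

text \<open>Time is a potential that increases by at least one unit along every edge except \<open>E_OI\<close>. By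
  \<open>circulation_potential\<close> the total flow on the other edges is at most the drop along \<open>E_OI\<close> times
  the flow on \<open>E_OI\<close>, which is the number of drivers.\<close>

lemma dispatch_circulation_bounded:
  assumes X: "valid_dispatch X"
  shows "\<exists>B. \<forall>f. circulation (dispatch_graph X) (lower X) (upper X) f \<longrightarrow>
    (\<forall>e\<in>arcs (dispatch_graph X). f e \<le> B)"
proof -
  \<comment> \<open>\<open>M\<close> dominates all slots, so that \<open>V_I\<close> lies before and \<open>V_O\<close> after every state.\<close>
  define M where "M = (\<Sum>t\<in>set (slots X). \<bar>t\<bar>)"
  define \<pi> :: "'a vertex \<Rightarrow> int" where
    "\<pi> v = (case v of V_I \<Rightarrow> - M - 1 | V_O \<Rightarrow> M + 1 | V_S s \<Rightarrow> snd s)" for v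
  define D where "D = (\<Sum>s\<in>states X. drivers X s)"
  have M: "\<bar>snd s\<bar> \<le> M" if "s \<in> states X" for s
    unfolding M_def by (rule member_le_sum) (use that in \<open>auto simp: states_def\<close>)
  have M0: "M \<ge> 0" by (simp add: M_def sum_nonneg)
  have later: "snd s < snd s'" if "(s, s') \<in> admissible X" for s s'
  proof -
    have "fst s \<in> set (locs X)" "snd s \<in> set (slots X)" "fst s' \<in> set (locs X)"
      using that by (auto simp: admissible_def states_def)
    then have "dur X (fst s) (fst s') (snd s) > 0"
      using X by (simp add: valid_dispatch_def)
    then show ?thesis
      using that by (simp add: admissible_def reaches_def)
  qed
  let ?A = "arcs (dispatch_graph X)"
  have rise: "1 \<le> \<pi> (edge_head e) - \<pi> (edge_tail e)" if e: "e \<in> ?A - {E_OI}" for e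
  proof (cases e)
    case (E_I s)
    then show ?thesis using e M[of s] by (auto simp: arcs_dispatch_graph \<pi>_def)
  next
    case (E_O s)
    then show ?thesis using e M[of s] by (auto simp: arcs_dispatch_graph \<pi>_def)
  next
    case (E_o s s')
    then show ?thesis using e later[of s s'] by (auto simp: arcs_dispatch_graph \<pi>_def)
  next
    case (E_w s s')
    then show ?thesis using e later[of s s'] by (auto simp: arcs_dispatch_graph \<pi>_def)
  qed (use e in simp)
  have ends: "edge_tail e \<in> verts (dispatch_graph X) \<and> edge_head e \<in> verts (dispatch_graph X)"
    if "e \<in> ?A" for e
    using that by (auto simp: arcs_dispatch_graph admissible_def)
  have "f e \<le> nat (2 * M + 2) * D"
    if f: "circulation (dispatch_graph X) (lower X) (upper X) f" and e: "e \<in> ?A" for f e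
  proof -
    have "f E_OI = (\<Sum>s\<in>states X. f (E_I s))"
      using f by (simp add: circulation_def in_arcs_I out_arcs_I sum.reindex inj_on_def)
    also have "\<dots> = D"
      unfolding D_def
    proof (rule sum.cong)
      fix s assume "s \<in> states X"
      then have "E_I s \<in> ?A" by (simp add: arcs_dispatch_graph)
      then have "lower X (E_I s) \<le> f (E_I s) \<and> enat (f (E_I s)) \<le> upper X (E_I s)"
        using f unfolding circulation_def by blast
      then show "f (E_I s) = drivers X s" by simp
    qed simp
    finally have OI: "f E_OI = D" .
    have "(\<Sum>e\<in>?A. int (f e) * (\<pi> (edge_head e) - \<pi> (edge_tail e))) = 0"
      using circulation_potential[OF _ _ _ f, of \<pi>] ends by simp
    moreover have "E_OI \<in> ?A" by (simp add: arcs_dispatch_graph)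
    ultimately have rest: "(\<Sum>e\<in>?A - {E_OI}. int (f e) * (\<pi> (edge_head e) - \<pi> (edge_tail e)))
        = (2 * M + 2) * int D"
      by (simp add: sum.remove[of ?A E_OI] \<pi>_def OI algebra_simps)
    show ?thesis
    proof (cases "e = E_OI")
      case True
      have "1 * D \<le> nat (2 * M + 2) * D" by (rule mult_right_mono) (use M0 in auto)
      then show ?thesis using True OI by simp
    next
      case False
      have "int (f e) * 1 \<le> int (f e) * (\<pi> (edge_head e) - \<pi> (edge_tail e))"
        using rise[of e] e False by (intro mult_left_mono) auto
      also have "\<dots> \<le> (\<Sum>e\<in>?A - {E_OI}. int (f e) * (\<pi> (edge_head e) - \<pi> (edge_tail e)))"
        proof (rule member_le_sum)
          show "e \<in> ?A - {E_OI}" using e False by simp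
          show "0 \<le> int (f e') * (\<pi> (edge_head e') - \<pi> (edge_tail e'))" if "e' \<in> ?A - {E_OI} - {e}" for e'
            using rise[of e'] that by simp
        qed simp
      finally have "int (f e) \<le> (2 * M + 2) * int D" using rest by simp
      then show ?thesis using M0 by (simp add: nat_mult_distrib flip: zle_int)
    qed
  qed
  then show ?thesis by blast
qed

section \<open>The split network\<close>

definition state_list :: "'l dispatch \<Rightarrow> 'l state list" where
  "state_list X = List.product (locs X) (slots X)"

definition admissible_list :: "'l dispatch \<Rightarrow> ('l state \<times> 'l state) list" where
  "admissible_list X =
     filter (\<lambda>(s, s'). reaches X s s') (List.product (state_list X) (state_list X))"

text \<open>The edges that the decomposition keeps: all but the edges \<open>E_w\<close>.\<close>

definition linear_edges :: "'l dispatch \<Rightarrow> 'l edge list" where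
  "linear_edges X = E_OI # map E_I (state_list X) @ map E_O (state_list X)
     @ map (case_prod E_o) (admissible_list X)"

definition unit_edges :: "'l dispatch \<Rightarrow> 'l split_edge list" where
  "unit_edges X = concat (map (\<lambda>(s, s'). map (Unit s s') [1..<Suc (num_orders X s s')])
     (admissible_list X))"

definition split_edges :: "'l dispatch \<Rightarrow> 'l split_edge list" where
  "split_edges X = unit_edges X @ map Kept (linear_edges X)"

definition marginal_reward :: "'l dispatch \<Rightarrow> 'l state \<Rightarrow> 'l state \<Rightarrow> nat \<Rightarrow> real" where
  "marginal_reward X s s' i = reward X i (E_w s s') - reward X (i - 1) (E_w s s')"

fun split_arc :: "'l dispatch \<Rightarrow> 'l split_edge \<Rightarrow> 'l vertex lin_arc" where
  "split_arc X (Unit s s' i) = \<lparr> arc_tail = V_S s, arc_head = V_S s', arc_lower = 0, arc_upper = 1,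
     arc_cost = - marginal_reward X s s' i \<rparr>"
| "split_arc X (Kept e) = \<lparr> arc_tail = edge_tail e, arc_head = edge_head e,
     arc_lower = lower X e, arc_upper = upper X e, arc_cost = - kept_weight X e \<rparr>"

definition split_network :: "'l dispatch \<Rightarrow> 'l vertex network" where
  "split_network X =
     (V_I # V_O # map V_S (state_list X), map (split_arc X) (split_edges X))"

text \<open>The same network with its edges named by labels instead of positions.\<close>

definition split_graph :: "'l dispatch \<Rightarrow> ('l vertex, 'l split_edge) pre_digraph" where
  "split_graph X =
    \<lparr> verts = verts (dispatch_graph X), arcs = set (split_edges X),
      tail = edge_tail \<circ> origin, head = edge_head \<circ> origin \<rparr>"

lemma set_state_list [simp]: "set (state_list X) = states X"
  by (simp add: state_list_def states_def)

lemma set_admissible_list [simp]: "set (admissible_list X) = admissible X"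
  by (auto simp: admissible_list_def admissible_def)

lemma distinct_state_list: "valid_dispatch X \<Longrightarrow> distinct (state_list X)"
  by (simp add: state_list_def valid_dispatch_def distinct_product)

lemma distinct_admissible_list: "valid_dispatch X \<Longrightarrow> distinct (admissible_list X)"
  by (simp add: admissible_list_def distinct_state_list distinct_product)

lemma set_linear_edges:
  "set (linear_edges X) = arcs (dispatch_graph X) - range (case_prod E_w)"
  by (auto simp: linear_edges_def arcs_dispatch_graph)

lemma set_unit_edges:
  "set (unit_edges X) = {Unit s s' i | s s' i. (s, s') \<in> admissible X \<and> i \<in> {1..num_orders X s s'}}"
  by (force simp: unit_edges_def)

lemma distinct_linear_edges: "valid_dispatch X \<Longrightarrow> distinct (linear_edges X)"
  using distinct_state_list[of X] distinct_admissible_list[of X]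
  by (auto simp: linear_edges_def distinct_map inj_on_def)

lemma distinct_unit_edges:
  assumes "valid_dispatch X"
  shows "distinct (unit_edges X)"
proof -
  have "distinct (concat (map (\<lambda>(s, s'). map (Unit s s') [1..<Suc (num_orders X s s')]) qs))"
    if "distinct qs" for qs
    using that by (induction qs) (auto simp: distinct_map inj_on_def)
  then show ?thesis
    using distinct_admissible_list[OF assms] by (simp add: unit_edges_def)
qed

lemma distinct_split_edges: "valid_dispatch X \<Longrightarrow> distinct (split_edges X)"
  by (auto simp: split_edges_def distinct_unit_edges distinct_linear_edges distinct_map inj_on_def
      set_unit_edges)

lemma set_split_edges:
  "set (split_edges X) = set (unit_edges X) \<union> Kept ` (arcs (dispatch_graph X) - range (case_prod E_w))"
  by (auto simp: split_edges_def set_linear_edges)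

lemma split_graph_simps [simp]:
  "verts (split_graph X) = verts (dispatch_graph X)" "arcs (split_graph X) = set (split_edges X)"
  "tail (split_graph X) = edge_tail \<circ> origin" "head (split_graph X) = edge_head \<circ> origin"
  by (simp_all add: split_graph_def)

lemma origin_split_edge: "x \<in> set (split_edges X) \<Longrightarrow> origin x \<in> arcs (dispatch_graph X)"
  by (auto simp: set_split_edges set_unit_edges arcs_dispatch_graph)

interpretation split: parallel_refinement "dispatch_graph X" "split_graph X" origin for X
  by unfold_locales (use origin_split_edge in simp_all)

lemma Unit_in_split_edges [simp]:
  "Unit s s' i \<in> set (split_edges X) \<longleftrightarrow> (s, s') \<in> admissible X \<and> i \<in> {1..num_orders X s s'}"
  unfolding set_split_edges set_unit_edges by blast

lemma Kept_in_split_edges [simp]: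
  "Kept e \<in> set (split_edges X) \<longleftrightarrow> e \<in> arcs (dispatch_graph X) \<and> (\<forall>s s'. e \<noteq> E_w s s')"
  unfolding set_split_edges set_unit_edges by auto

lemma fibre_E_w:
  assumes "(s, s') \<in> admissible X"
  shows "split.fibre X (E_w s s') = Unit s s' ` {1..num_orders X s s'}"
proof (rule set_eqI)
  show "x \<in> split.fibre X (E_w s s') \<longleftrightarrow> x \<in> Unit s s' ` {1..num_orders X s s'}" for x
    using assms by (cases x) (auto simp: split.fibre_def simp del: split_paired_All)
qed

lemma fibre_linear_edge:
  assumes "e \<in> arcs (dispatch_graph X)" "\<And>s s'. e \<noteq> E_w s s'"
  shows "split.fibre X e = {Kept e}"
proof (rule set_eqI)
  show "x \<in> split.fibre X e \<longleftrightarrow> x \<in> {Kept e}" for x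
    using assms by (cases x) (auto simp: split.fibre_def)
qed

lemma split_fibre_cases:
  assumes "e \<in> arcs (dispatch_graph X)"
  obtains (order) s s' where "e = E_w s s'" "(s, s') \<in> admissible X"
      "split.fibre X e = Unit s s' ` {1..num_orders X s s'}"
    | (linear) "\<And>s s'. e \<noteq> E_w s s'" "split.fibre X e = {Kept e}"
proof (cases "\<exists>s s'. e = E_w s s'")
  case True
  then obtain s s' where e: "e = E_w s s'" by blast
  then have "(s, s') \<in> admissible X" using assms by (auto simp: arcs_dispatch_graph)
  then show ?thesis using order e fibre_E_w by metis
next
  case False
  then show ?thesis using linear fibre_linear_edge[OF assms] by blast
qed

abbreviation split_lower :: "'l dispatch \<Rightarrow> 'l split_edge \<Rightarrow> nat" where
  "split_lower X x \<equiv> arc_lower (split_arc X x)"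

abbreviation split_upper :: "'l dispatch \<Rightarrow> 'l split_edge \<Rightarrow> enat" where
  "split_upper X x \<equiv> arc_upper (split_arc X x)"

abbreviation split_cost :: "'l dispatch \<Rightarrow> 'l split_edge \<Rightarrow> real" where
  "split_cost X x \<equiv> arc_cost (split_arc X x)"

abbreviation within_capacities :: "'l dispatch \<Rightarrow> ('l split_edge \<Rightarrow> nat) \<Rightarrow> 'l edge \<Rightarrow> bool" where
  "within_capacities X g e \<equiv>
     \<forall>x\<in>split.fibre X e. split_lower X x \<le> g x \<and> enat (g x) \<le> split_upper X x"

text \<open>The capacity of an order edge is the number of its unit edges, each of capacity one.\<close>

lemma merge_within_bounds:
  assumes e: "e \<in> arcs (dispatch_graph X)" and g: "within_capacities X g e"
  shows "lower X e \<le> split.merge X g e \<and> enat (split.merge X g e) \<le> upper X e"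
  using e
proof (cases rule: split_fibre_cases)
  case (order s s')
  have "split.merge X g e = (\<Sum>i=1..num_orders X s s'. g (Unit s s' i))"
    unfolding split.merge_def order(3) by (simp add: sum.reindex inj_on_def)
  also have "\<dots> \<le> num_orders X s s'"
    using sum_bounded_above[of "{1..num_orders X s s'}" "\<lambda>i. g (Unit s s' i)" 1] g
    unfolding order(3) by (simp add: one_enat_def)
  finally show ?thesis by (simp add: order(1))
next
  case linear
  then show ?thesis using g by (simp add: split.merge_def)
qed

text \<open>A flow of \<open>k\<close> units on an order edge takes its first \<open>k\<close> unit edges, whose increments
  telescope to the reward at \<open>k\<close>.\<close>

fun greedy_split :: "('l edge \<Rightarrow> nat) \<Rightarrow> 'l split_edge \<Rightarrow> nat" where
  "greedy_split f (Unit s s' i) = of_bool (i \<le> f (E_w s s'))"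
| "greedy_split f (Kept e) = f e"

lemma reward_linear_edge: "(\<And>s s'. e \<noteq> E_w s s') \<Longrightarrow> reward X k e = kept_weight X e * real k"
  by (cases e) auto

lemma sum_marginal_reward: "(\<Sum>i=1..k. marginal_reward X s s' i) = reward X k (E_w s s')"
  by (induction k) (auto simp: marginal_reward_def)

lemma greedy_split:
  assumes e: "e \<in> arcs (dispatch_graph X)" and f: "lower X e \<le> f e" "enat (f e) \<le> upper X e"
  shows "split.merge X (greedy_split f) e = f e \<and> within_capacities X (greedy_split f) e
    \<and> (\<Sum>x\<in>split.fibre X e. - split_cost X x * real (greedy_split f x)) = reward X (f e) e"
  using e
proof (cases rule: split_fibre_cases)
  case (order s s')
  define n where "n = num_orders X s s'"
  let ?w = "marginal_reward X s s'"
  have "f e \<le> n" using f by (simp add: order(1) n_def)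
  then have prefix: "{1..n} \<inter> {i. i \<le> f e} = {1..f e}" by auto
  have "split.merge X (greedy_split f) e = card ({1..n} \<inter> {i. i \<le> f e})"
    unfolding split.merge_def order(3) n_def[symmetric]
    by (simp add: sum.reindex inj_on_def order(1) sum.If_cases of_bool_def)
  then have "split.merge X (greedy_split f) e = f e" unfolding prefix by simp
  moreover have "within_capacities X (greedy_split f) e"
    by (auto simp: order(3) one_enat_def)
  moreover have "(\<Sum>x\<in>split.fibre X e. - split_cost X x * real (greedy_split f x))
      = reward X (f e) e"
  proof -
    have "(\<Sum>x\<in>split.fibre X e. - split_cost X x * real (greedy_split f x))
        = (\<Sum>i=1..n. ?w i * of_bool (i \<le> f e))"
      unfolding order(3) n_def[symmetric] by (simp add: sum.reindex inj_on_def order(1))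
    also have "\<dots> = (\<Sum>i\<in>{1..n} \<inter> {i. i \<le> f e}. ?w i)"
      by (simp add: sum.inter_restrict of_bool_def if_distrib cong: if_cong)
    also have "\<dots> = reward X (f e) e"
      unfolding prefix sum_marginal_reward order(1)[symmetric] by (rule refl)
    finally show ?thesis .
  qed
  ultimately show ?thesis by blast
next
  case linear
  then show ?thesis using f by (simp add: split.merge_def reward_linear_edge)
qed

text \<open>The cost \<open>c\<close> enters the reward linearly, so it shifts all increments by the same amount; thus
  \<open>regular\<close> makes the increments non-increasing.\<close>

lemma marginal_reward_eq:
  assumes "i \<ge> 1"
  shows "marginal_reward X s s' i = modified_valuation X s s' i - cost X s s'"
  using assms by (cases "i = 1") (auto simp: marginal_reward_def modified_valuation_def algebra_simps)

lemma split_reward_le: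
  assumes X: "regular X" and e: "e \<in> arcs (dispatch_graph X)" and g: "within_capacities X g e"
  shows "(\<Sum>x\<in>split.fibre X e. - split_cost X x * real (g x)) \<le> reward X (split.merge X g e) e"
  using e
proof (cases rule: split_fibre_cases)
  case (order s s')
  define n where "n = num_orders X s s'"
  let ?w = "marginal_reward X s s'"
  have "antimono_on {1..n} (modified_valuation X s s')"
    using X order(2) by (auto simp: regular_def n_def)
  moreover have "?w i = modified_valuation X s s' i - cost X s s'" if "i \<in> {1..n}" for i
    using that by (simp only: marginal_reward_eq atLeastAtMost_iff)
  ultimately have "antimono_on {1..n} ?w"
    unfolding monotone_on_def by simp
  moreover have "\<forall>i\<in>{1..n}. g (Unit s s' i) \<le> 1"
    using g by (auto simp: order(3) n_def one_enat_def)
  ultimately have "(\<Sum>i=1..n. ?w i * real (g (Unit s s' i))) \<le> (\<Sum>i=1..(\<Sum>i=1..n. g (Unit s s' i)). ?w i)"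
    by (rule sum_unit_selection_le_prefix)
  also have "(\<Sum>i=1..n. g (Unit s s' i)) = split.merge X g e"
    by (simp add: split.merge_def order(3) n_def sum.reindex inj_on_def)
  also have "(\<Sum>i=1..split.merge X g e. ?w i) = reward X (split.merge X g e) e"
    unfolding sum_marginal_reward order(1) ..
  finally show ?thesis
    by (simp add: order(3) sum.reindex inj_on_def n_def sum_negf)
next
  case linear
  then show ?thesis by (simp add: split.merge_def reward_linear_edge)
qed

text \<open>Both feasibility and boundedness are inherited from the dispatch graph: the former by splitting a
  flow, the latter because a unit edge carries at most the flow of the merged edge.\<close>

lemma split_min_cost_exists:
  assumes "valid_dispatch X"
  shows "\<exists>g. min_cost_circulation (split_graph X) (split_lower X) (split_upper X) (split_cost X) g"
proof -
  obtain B where B: "f e \<le> B" if "circulation (dispatch_graph X) (lower X) (upper X) f"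
      "e \<in> arcs (dispatch_graph X)" for f e
    using dispatch_circulation_bounded[OF assms] by blast
  show ?thesis
  proof (rule min_cost_circulation_exists)
    show "finite (arcs (split_graph X))" by (rule split.finite_H)
    show "circulation (split_graph X) (split_lower X) (split_upper X) (greedy_split (idle_flow X))"
    proof (rule split.circulation_split[OF circulation_idle_flow])
      fix e assume "e \<in> arcs (dispatch_graph X)"
      then show "split.merge X (greedy_split (idle_flow X)) e = idle_flow X e
          \<and> within_capacities X (greedy_split (idle_flow X)) e"
        using greedy_split[of e X "idle_flow X"] circulation_idle_flow[of X]
        unfolding circulation_def by blast
    qed
    fix g x assume g: "circulation (split_graph X) (split_lower X) (split_upper X) g"
      and x: "x \<in> arcs (split_graph X)"
    have "g x \<le> split.merge X g (origin x)"
      unfolding split.merge_def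
      by (rule member_le_sum) (use x split.finite_H in \<open>auto simp: split.fibre_def\<close>)
    also have "\<dots> \<le> B"
      using split.circulation_merge[OF g merge_within_bounds] split.origin_arc[OF x] B by blast
    finally show "g x \<le> B" .
  qed
qed

text \<open>Regularity yields \<open>concave\<close>, the greedy distribution yields \<open>attained\<close>.\<close>

lemma max_revenue_merge:
  assumes "regular X"
    and "min_cost_circulation (split_graph X) (split_lower X) (split_upper X) (split_cost X) g"
  shows "max_revenue_flow X (split.merge X g)"
  unfolding max_revenue_flow_def
  by (rule split.optimal_merge[OF assms(2) merge_within_bounds split_reward_le[OF assms(1)] greedy_split])

section \<open>Networks with labelled arcs\<close>

lemma flow_of_zip:
  assumes "distinct xs" "length ks = length xs" "i < length xs"
  shows "flow_of (zip xs ks) (xs ! i) = ks ! i"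
  using assms by (simp add: flow_of_def map_of_zip_nth)

lemma flow_of_graph: "e \<in> set es \<Longrightarrow> flow_of (map (\<lambda>e. (e, F e)) es) e = F e"
  by (simp add: flow_of_def map_of_map_restrict)

text \<open>The solver identifies arcs by their positions, the argument above by labels. As the labels are
  distinct, circulations for the two namings correspond to each other and cost the same.\<close>

lemma network_min_cost_labelled:
  fixes a :: "'x \<Rightarrow> 'v lin_arc"
  assumes dist: "distinct xs" and g: "\<And>i. i < length xs \<Longrightarrow> g i = h (xs ! i)"
    and verts: "verts H = set vs" and arcs: "arcs H = set xs"
    and ends: "\<And>x. x \<in> set xs \<Longrightarrow> tail H x = arc_tail (a x) \<and> head H x = arc_head (a x)"
  shows "network_min_cost (vs, map a xs) g \<longleftrightarrow>
    min_cost_circulation H (arc_lower \<circ> a) (arc_upper \<circ> a) (arc_cost \<circ> a) h"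
proof -
  let ?N = "network_graph (vs, map a xs)"
  let ?n = "length xs"
  let ?l = "\<lambda>i. arc_lower (map a xs ! i)" and ?u = "\<lambda>i. arc_upper (map a xs ! i)"
  let ?rel = "\<lambda>g h. \<forall>i<?n. g i = h (xs ! i)"
  have bij: "bij_betw ((!) xs) {..<?n} (set xs)"
    using bij_betw_nth[OF dist refl refl] .
  have sums: "(\<Sum>i | i < ?n \<and> P (xs ! i). k i) = (\<Sum>x | x \<in> set xs \<and> P x. k' x)"
    if "\<And>i. i < ?n \<Longrightarrow> k i = k' (xs ! i)" for P and k :: "nat \<Rightarrow> 'c::comm_monoid_add" and k'
  proof -
    have "bij_betw ((!) xs) {i. i < ?n \<and> P (xs ! i)} {x. x \<in> set xs \<and> P x}"
      using bij unfolding bij_betw_def inj_on_def by (auto simp: in_set_conv_nth image_iff)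
    then show ?thesis
      using that by (auto intro!: sum.reindex_bij_betw[THEN trans, rotated] sum.cong
          simp flip: sum.reindex_bij_betw[of _ _ _ k'])
  qed
  have circ: "circulation ?N ?l ?u g \<longleftrightarrow> circulation H (arc_lower \<circ> a) (arc_upper \<circ> a) h"
    if rel: "?rel g h" for g h
  proof -
    have "(\<Sum>i\<in>in_arcs ?N v. g i) = (\<Sum>x\<in>in_arcs H v. h x)" for v
    proof -
      have "in_arcs ?N v = {i. i < ?n \<and> arc_head (a (xs ! i)) = v}"
        "in_arcs H v = {x. x \<in> set xs \<and> arc_head (a x) = v}"
        using ends by (auto simp: network_graph_def arcs)
      then show ?thesis using sums[of g h "\<lambda>x. arc_head (a x) = v"] rel by simp
    qed
    moreover have "(\<Sum>i\<in>out_arcs ?N v. g i) = (\<Sum>x\<in>out_arcs H v. h x)" for v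
    proof -
      have "out_arcs ?N v = {i. i < ?n \<and> arc_tail (a (xs ! i)) = v}"
        "out_arcs H v = {x. x \<in> set xs \<and> arc_tail (a x) = v}"
        using ends by (auto simp: network_graph_def arcs)
      then show ?thesis using sums[of g h "\<lambda>x. arc_tail (a x) = v"] rel by simp
    qed
    moreover have "(\<forall>i\<in>arcs ?N. ?l i \<le> g i \<and> enat (g i) \<le> ?u i)
        \<longleftrightarrow> (\<forall>x\<in>arcs H. (arc_lower \<circ> a) x \<le> h x \<and> enat (h x) \<le> (arc_upper \<circ> a) x)"
      using rel by (auto simp: network_graph_def arcs all_set_conv_all_nth)
    moreover have "verts ?N = verts H" by (simp add: network_graph_def verts)
    ultimately show ?thesis unfolding circulation_def by simp
  qed
  have cost: "(\<Sum>i\<in>arcs ?N. arc_cost (map a xs ! i) * real (g i))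
      = (\<Sum>x\<in>arcs H. (arc_cost \<circ> a) x * real (h x))" if rel: "?rel g h" for g h
  proof -
    have "arcs ?N = {i. i < ?n \<and> True}" "arcs H = {x. x \<in> set xs \<and> True}"
      by (auto simp: network_graph_def arcs)
    then show ?thesis
      using sums[of "\<lambda>i. arc_cost (map a xs ! i) * real (g i)"
          "\<lambda>x. (arc_cost \<circ> a) x * real (h x)" "\<lambda>_. True"] rel by simp
  qed
  have to_h: "\<exists>h. ?rel g h" for g :: "nat \<Rightarrow> nat"
    using flow_of_zip[OF dist, of "map g [0..<?n]"]
    by (intro exI[of _ "flow_of (zip xs (map g [0..<?n]))"]) auto
  have to_g: "\<exists>g. ?rel g h" for h :: "'x \<Rightarrow> nat" by (rule exI[of _ "h \<circ> (!) xs"]) simp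
  have gh: "?rel g h" using g by simp
  let ?cN = "\<lambda>g. \<Sum>i\<in>arcs ?N. arc_cost (map a xs ! i) * real (g i)"
  let ?cH = "\<lambda>h. \<Sum>x\<in>arcs H. (arc_cost \<circ> a) x * real (h x)"
  have "(\<forall>g'. circulation ?N ?l ?u g' \<longrightarrow> ?cN g \<le> ?cN g')
      \<longleftrightarrow> (\<forall>h'. circulation H (arc_lower \<circ> a) (arc_upper \<circ> a) h' \<longrightarrow> ?cH h \<le> ?cH h')" (is "?L \<longleftrightarrow> ?R")
  proof
    show ?R if ?L
    proof (intro allI impI)
      fix h' assume h': "circulation H (arc_lower \<circ> a) (arc_upper \<circ> a) h'"
      obtain g' where g': "?rel g' h'" using to_g by blast
      show "?cH h \<le> ?cH h'" using that h' unfolding circ[OF g', symmetric] cost[OF g', symmetric] cost[OF gh, symmetric] by blast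
    qed
    show ?L if ?R
    proof (intro allI impI)
      fix g' assume g': "circulation ?N ?l ?u g'"
      obtain h' where h': "?rel g' h'" using to_h by blast
      show "?cN g \<le> ?cN g'" using that g' unfolding circ[OF h'] cost[OF h'] cost[OF gh] by blast
    qed
  qed
  then show ?thesis
    unfolding network_min_cost_def min_cost_circulation_def snd_conv circ[OF gh] by blast
qed

lemma split_network_min_cost:
  assumes "valid_dispatch X" "\<And>i. i < length (split_edges X) \<Longrightarrow> g i = h (split_edges X ! i)"
  shows "network_min_cost (split_network X) g
    \<longleftrightarrow> min_cost_circulation (split_graph X) (split_lower X) (split_upper X) (split_cost X) h"
  unfolding split_network_def
  using network_min_cost_labelled[OF distinct_split_edges[OF assms(1)], of g h "split_graph X"
      "V_I # V_O # map V_S (state_list X)" "split_arc X"] assms(2)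
  by (fastforce simp: o_def set_split_edges set_unit_edges)

lemma valid_split_network: "valid_dispatch X \<Longrightarrow> valid_network (split_network X)"
  by (auto simp: valid_network_def split_network_def distinct_state_list distinct_map inj_on_def
      set_split_edges set_unit_edges arcs_dispatch_graph admissible_def)

text \<open>The length of the answer matters because zipping the labels with a shorter list would lose edges.\<close>

lemma max_revenue_of_solver:
  assumes "solves_min_cost_circulation mcc" "valid_dispatch X" "regular X"
  shows "length (fst (mcc (split_network X))) = length (split_edges X)" (is "length ?ks = _")
    and "max_revenue_flow X
      (split.merge X (flow_of (zip (split_edges X) (fst (mcc (split_network X))))))"
proof -
  obtain h where "min_cost_circulation (split_graph X) (split_lower X) (split_upper X) (split_cost X) h"
    using split_min_cost_exists[OF assms(2)] by blast
  then have "network_min_cost (split_network X) (\<lambda>i. h (split_edges X ! i))"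
    using split_network_min_cost[OF assms(2), of "\<lambda>i. h (split_edges X ! i)" h] by simp
  then have "length ?ks = length (snd (split_network X)) \<and> network_min_cost (split_network X) ((!) ?ks)"
    using assms(1) valid_split_network[OF assms(2)]
    unfolding solves_min_cost_circulation_def by blast
  then have sol: "length ?ks = length (split_edges X)" "network_min_cost (split_network X) ((!) ?ks)"
    by (simp_all add: split_network_def)
  show "length ?ks = length (split_edges X)" by (fact sol(1))
  show "max_revenue_flow X (split.merge X (flow_of (zip (split_edges X) ?ks)))"
    using sol flow_of_zip[OF distinct_split_edges[OF assms(2)] sol(1)]
      split_network_min_cost[OF assms(2), of "(!) ?ks"] max_revenue_merge[OF assms(3)]
    by metis
qed

section \<open>Results of the timed programs\<close>

lemma timed_simps [simp]:
  "fst (charge n x) = x" "snd (charge n x) = n"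
  "fst (bind_timed m k) = fst (k (fst m))"
  "snd (bind_timed m k) = snd m + snd (k (fst m))"
  by (simp_all add: charge_def bind_timed_def)

lemma scan_simps [simp]: "fst (scan X x) = x" "snd (scan X x) = Suc (input_size X)"
  by (simp_all add: scan_def)

lemma arith_simps [simp]:
  "fst (arith f x y) = f x y" "snd (arith f x y) = (real_bits x + real_bits y)\<^sup>2"
  by (simp_all add: arith_def)

lemma fst_map_timed [simp]: "fst (map_timed f xs) = map (\<lambda>x. fst (f x)) xs"
  by (induction xs) auto

lemma fst_filter_timed [simp]: "fst (filter_timed P xs) = filter (\<lambda>x. fst (P x)) xs"
  by (induction xs) auto

lemma append_timed_simps [simp]:
  "fst (append_timed xs ys) = xs @ ys" "snd (append_timed xs ys) = Suc (length xs)"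
  by (induction xs) auto

lemma concat_timed_simps [simp]:
  "fst (concat_timed xss) = concat xss"
  "snd (concat_timed xss) = Suc (length xss + length (concat xss))"
  by (induction xss) auto

lemma zip_timed_simps [simp]:
  "fst (zip_timed xs ys) = zip xs ys" "snd (zip_timed xs ys) = Suc (min (length xs) (length ys))"
  by (induction xs ys rule: zip_timed.induct) auto

lemma snd_map_timed_le:
  "(\<And>x. x \<in> set xs \<Longrightarrow> snd (f x) \<le> c) \<Longrightarrow> snd (map_timed f xs) \<le> Suc (length xs * Suc c)"
proof (induction xs)
  case (Cons x xs)
  then have "snd (f x) + snd (map_timed f xs) \<le> c + Suc (length xs * Suc c)"
    by (intro add_mono) auto
  then show ?case by simp
qed simp

lemma snd_filter_timed_le:
  "(\<And>x. x \<in> set xs \<Longrightarrow> snd (P x) \<le> c) \<Longrightarrow> snd (filter_timed P xs) \<le> Suc (length xs * Suc c)"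
proof (induction xs)
  case (Cons x xs)
  then have "snd (P x) + snd (filter_timed P xs) \<le> c + Suc (length xs * Suc c)"
    by (intro add_mono) auto
  then show ?case by simp
qed simp

lemma snd_map_scan [simp]:
  "snd (map_timed (\<lambda>x. scan X (f x)) xs) = Suc (length xs * (input_size X + 2))"
  "snd (map_timed (\<lambda>(x, y). scan X (g x y)) qs) = Suc (length qs * (input_size X + 2))"
  by (induction xs) (auto, induction qs, auto)

lemma snd_map_charge [simp]: "snd (map_timed (\<lambda>x. charge 1 (f x)) xs) = Suc (2 * length xs)"
  by (induction xs) auto

lemma fst_sum_timed [simp]: "fst (sum_timed xs) = sum_list xs"
  by (induction xs) auto

lemma insert_desc_correct:
  "mset (fst (insert_desc x ys)) = add_mset x (mset ys)"
  "sorted_wrt (\<ge>) ys \<Longrightarrow> sorted_wrt (\<ge>) (fst (insert_desc x ys))"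
proof -
  show mset: "mset (fst (insert_desc x ys)) = add_mset x (mset ys)" for ys
    by (induction ys) auto
  have set: "set (fst (insert_desc x ys)) = insert x (set ys)" for ys
    using arg_cong[OF mset[of ys], of set_mset] by simp
  show "sorted_wrt (\<ge>) ys \<Longrightarrow> sorted_wrt (\<ge>) (fst (insert_desc x ys))"
    by (induction ys) (auto simp: set)
qed

lemma fst_sort_desc [simp]: "fst (sort_desc xs) = rev (sort xs)"
proof -
  have "mset (fst (sort_desc xs)) = mset xs \<and> sorted_wrt (\<ge>) (fst (sort_desc xs))"
    by (induction xs) (auto simp: insert_desc_correct)
  then have "rev (fst (sort_desc xs)) = sort xs"
    by (intro properties_for_sort[symmetric]) (auto simp: sorted_wrt_rev)
  then show ?thesis by (simp add: rev_swap)
qed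

lemma fst_list_states [simp]: "fst (list_states X) = state_list X"
proof -
  have "concat (map (\<lambda>x. map (Pair x) ys) xs) = List.product xs ys" for xs :: "'a list" and ys :: "int list"
    by (induction xs) auto
  then show ?thesis by (simp add: list_states_def state_list_def)
qed

lemma fst_list_admissible [simp]: "fst (list_admissible X (state_list X)) = admissible_list X"
proof -
  have "concat (map (\<lambda>s. map (Pair s) (filter (reaches X s) ys)) xs)
      = filter (\<lambda>(s, s'). reaches X s s') (List.product xs ys)" for xs ys
    by (induction xs) (auto simp: filter_map o_def)
  then show ?thesis by (simp add: list_admissible_def admissible_list_def)
qed

lemma fst_sorted_valuations [simp]:
  "fst (sorted_valuations X s s') = rev (sort (valuations X s s'))"
  by (simp add: sorted_valuations_def valuations_def case_prod_unfold)

text \<open>The accumulator \<open>r\<close> of \<open>unit_arcs\<close> is the reward at \<open>i - 1\<close>, which the recursion replaces by the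
  reward at \<open>i\<close>. For \<open>i = 1\<close> it is 0, the reward of the empty flow.\<close>

lemma fst_unit_arcs:
  assumes "i \<ge> 1" "\<And>j. j < length vs \<Longrightarrow> vs ! j = kth_valuation X s s' (i + j)"
  shows "fst (unit_arcs X s s' (reward X (i - 1) (E_w s s')) i vs)
    = map (\<lambda>j. (Unit s s' j, split_arc X (Unit s s' j))) [i..<i + length vs]"
  using assms
proof (induction vs arbitrary: i)
  case Nil
  then show ?case by simp
next
  case (Cons v vs)
  have v: "v = kth_valuation X s s' i"
    using Cons.prems(2)[of 0] by simp
  have r: "(v - cost X s s') * real i = reward X i (E_w s s')"
    using Cons.prems(1) v by simp
  have IH: "fst (unit_arcs X s s' (reward X i (E_w s s')) (Suc i) vs)
      = map (\<lambda>j. (Unit s s' j, split_arc X (Unit s s' j))) [Suc i..<Suc i + length vs]"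
    using Cons.IH[of "Suc i"] Cons.prems(2)[of "Suc j" for j] by simp
  show ?case
    using IH by (simp add: r marginal_reward_def upt_conv_Cons del: reward.simps upt_Suc)
qed

lemma fst_decomposed_arcs [simp]:
  "fst (decomposed_arcs X (s, s')) =
    map (\<lambda>i. (Unit s s' i, split_arc X (Unit s s' i))) [1..<Suc (num_orders X s s')]"
  using fst_unit_arcs[of 1 "rev (sort (valuations X s s'))" X s s']
  by (simp add: decomposed_arcs_def kth_valuation_def num_orders_def del: upt_Suc split_arc.simps)

lemma fst_kept_arc [simp]: "fst (kept_arc X e) = (Kept e, split_arc X (Kept e))"
  by (simp add: kept_arc_def)

definition all_edges :: "'l dispatch \<Rightarrow> 'l edge list" where
  "all_edges X = map (case_prod E_w) (admissible_list X) @ linear_edges X"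

definition flow_table :: "('l vertex network \<Rightarrow> nat list timed) \<Rightarrow> 'l dispatch \<Rightarrow> ('l split_edge \<times> nat) list"
  where "flow_table mcc X = zip (split_edges X) (fst (mcc (split_network X)))"

lemma concat_decomposed_arcs:
  "concat (map (\<lambda>q. fst (decomposed_arcs X q)) (admissible_list X))
    = map (\<lambda>x. (x, split_arc X x)) (unit_edges X)"
proof -
  have "fst (decomposed_arcs X q) = map (\<lambda>x. (x, split_arc X x))
      (case q of (s, s') \<Rightarrow> map (Unit s s') [1..<Suc (num_orders X s s')])" for q
    by (cases q rule: prod.exhaust) (simp add: o_def del: upt_Suc split_arc.simps)
  then show ?thesis by (simp only: unit_edges_def map_concat map_map o_def)
qed

lemma fst_map_scan: "fst (map_timed (\<lambda>x. scan X (g x)) xs) = map g xs"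
  "fst (map_timed (\<lambda>(x, y). scan X (g' x y)) qs) = map (case_prod g') qs"
  by (simp, induction qs) auto

lemma fst_linear_edges:
  "fst (concat_timed [[E_OI], map E_I (state_list X), map E_O (state_list X),
     map (case_prod E_o) (admissible_list X)]) = linear_edges X"
  by (simp add: linear_edges_def)

lemma fst_split_edges:
  "fst (append_timed (fst (concat_timed (fst (map_timed (decomposed_arcs X) (admissible_list X)))))
     (fst (map_timed (kept_arc X) (linear_edges X))))
   = map (\<lambda>x. (x, split_arc X x)) (split_edges X)"
  by (simp add: concat_decomposed_arcs split_edges_def)

lemma fst_all_edges:
  "fst (append_timed (map (case_prod E_w) (admissible_list X)) (linear_edges X)) = all_edges X"
  by (simp add: all_edges_def)

lemma fst_map_charge_pairs:
  "fst (map_timed (\<lambda>a. charge 1 (fst a)) (map (\<lambda>x. (x, f x)) xs)) = xs"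
  "fst (map_timed (\<lambda>a. charge 1 (snd a)) (map (\<lambda>x. (x, f x)) xs)) = map f xs"
  by (simp_all add: o_def)

text \<open>Rewriting with these rules evaluates the results of all steps of the algorithm but leaves the
  times of the steps as summands.\<close>

lemmas edge_decomposition_steps =
  edge_decomposition_def timed_simps(3,4) fst_list_states fst_list_admissible fst_map_scan
  fst_linear_edges fst_split_edges fst_map_charge_pairs split_network_def[symmetric]
  zip_timed_simps(1) flow_table_def[symmetric] fst_all_edges

lemma fst_edge_decomposition:
  "fst (edge_decomposition mcc X) = fst (map_timed (recombine X (flow_table mcc X)) (all_edges X))"
  unfolding edge_decomposition_steps by (rule refl)

section \<open>Lengths of numbers\<close>

lemma nat_bits_mono: "m \<le> n \<Longrightarrow> nat_bits m \<le> nat_bits n"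
  by (simp add: nat_bits_def floorlog_mono)

lemma nat_bits_pos: "1 \<le> nat_bits n"
  by (simp add: nat_bits_def)

lemma less_two_power_floorlog: "n < 2 ^ floorlog 2 n"
  by (rule floorlog_leD) auto

lemma nat_bits_leI: "n < 2 ^ k \<Longrightarrow> nat_bits n \<le> Suc k"
  by (simp add: nat_bits_def floorlog_leI)

lemma nat_bits_le_Suc: "nat_bits n \<le> Suc n"
  by (rule nat_bits_leI) simp

lemma nat_bits_mult: "nat_bits (m * n) \<le> nat_bits m + nat_bits n"
proof -
  have "m * n < 2 ^ (floorlog 2 m + floorlog 2 n)"
    unfolding power_add by (intro mult_strict_mono less_two_power_floorlog) auto
  from nat_bits_leI[OF this] show ?thesis by (simp add: nat_bits_def)
qed

lemma nat_bits_add: "nat_bits (m + n) \<le> nat_bits m + nat_bits n"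
proof -
  let ?i = "floorlog 2 m" and ?j = "floorlog 2 n"
  have "m + n < 2 ^ ?i + 2 ^ ?j"
    by (intro add_strict_mono less_two_power_floorlog)
  also have "\<dots> \<le> 2 ^ (?i + ?j) + 2 ^ (?i + ?j)"
    by (intro add_mono power_increasing) auto
  also have "\<dots> = 2 ^ Suc (?i + ?j)" by simp
  finally have "nat_bits (m + n) \<le> Suc (Suc (?i + ?j))" by (rule nat_bits_leI)
  then show ?thesis by (simp add: nat_bits_def)
qed

lemma int_bits_le_of_abs_le: "\<bar>a\<bar> \<le> \<bar>b\<bar> \<Longrightarrow> int_bits a \<le> int_bits b"
  unfolding int_bits_def by (intro Suc_le_mono[THEN iffD2] nat_bits_mono nat_mono)

lemma int_bits_mult: "int_bits (a * b) \<le> int_bits a + int_bits b"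
  using nat_bits_mult[of "nat \<bar>a\<bar>" "nat \<bar>b\<bar>"] by (simp add: int_bits_def abs_mult nat_mult_distrib)

lemma int_bits_diff: "int_bits (a - b) \<le> int_bits a + int_bits b"
proof -
  have "nat \<bar>a - b\<bar> \<le> nat \<bar>a\<bar> + nat \<bar>b\<bar>" by linarith
  from nat_bits_mono[OF this] show ?thesis
    using nat_bits_add[of "nat \<bar>a\<bar>" "nat \<bar>b\<bar>"] by (simp add: int_bits_def)
qed

lemma real_bits_of_rat: "real_bits (of_rat r) = (case quotient_of r of (p, q) \<Rightarrow> int_bits p + int_bits q)"
  by (simp add: real_bits_def the_inv_f_f inj_on_def)

text \<open>\<open>real_bits\<close> measures lowest terms, and reducing a fraction replaces its numerator and its denominator
  by divisors.\<close>

lemma real_bits_fraction_le: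
  assumes "b \<noteq> 0"
  shows "real_bits (of_int a / of_int b) \<le> int_bits a + int_bits b"
proof -
  obtain p q where pq: "quotient_of (Fract a b) = (p, q)" by fastforce
  have q: "q > 0" and cop: "coprime p q"
    using quotient_of_denom_pos[OF pq] quotient_of_coprime[OF pq] by auto
  have "Fract p q = Fract a b" using quotient_of_eq[OF pq] .
  then have cross: "p * b = a * q" using q assms by (simp add: eq_rat)
  then have "p dvd a * q" "q dvd p * b" by (metis dvd_triv_left, simp)
  then have dvd: "p dvd a" "q dvd b"
    using cop by (simp_all add: coprime_dvd_mult_left_iff coprime_dvd_mult_right_iff coprime_commute)
  have "\<bar>p\<bar> \<le> \<bar>a\<bar>"
  proof (cases "a = 0")
    case True
    then show ?thesis using cross assms by simp
  qed (use dvd(1) dvd_imp_le_int in auto)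
  moreover have "\<bar>q\<bar> \<le> \<bar>b\<bar>" using dvd(2) dvd_imp_le_int assms by blast
  moreover have "of_int a / of_int b = (of_rat (Fract a b) :: real)"
    using assms by (simp add: of_rat_rat)
  ultimately show ?thesis
    by (simp add: real_bits_of_rat pq add_mono int_bits_le_of_abs_le del: of_rat_divide)
qed

lemma rational_fraction:
  assumes "x \<in> \<rat>"
  obtains p q where "x = of_int p / of_int q" "q \<noteq> 0" "real_bits x = int_bits p + int_bits q"
proof -
  obtain r where r: "x = of_rat r" using assms by (auto simp: Rats_def)
  obtain p q where pq: "quotient_of r = (p, q)" by fastforce
  have "x = of_int p / of_int q"
    using quotient_of_div[OF pq] by (simp add: r of_rat_divide)
  then show ?thesis
    using that[of p q] quotient_of_denom_pos[OF pq] real_bits_of_rat[of r] by (simp add: r pq)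
qed

lemma real_bits_diff:
  assumes "x \<in> \<rat>" "y \<in> \<rat>"
  shows "real_bits (x - y) \<le> 2 * (real_bits x + real_bits y)"
proof -
  obtain p q where x: "x = of_int p / of_int q" "q \<noteq> 0" "real_bits x = int_bits p + int_bits q"
    using assms(1) by (rule rational_fraction)
  obtain p' q' where y: "y = of_int p' / of_int q'" "q' \<noteq> 0" "real_bits y = int_bits p' + int_bits q'"
    using assms(2) by (rule rational_fraction)
  have "x - y = of_int (p * q' - p' * q) / of_int (q * q')"
    using x(2) y(2) by (simp add: x(1) y(1) field_simps)
  then have "real_bits (x - y) \<le> int_bits (p * q' - p' * q) + int_bits (q * q')"
    using real_bits_fraction_le[of "q * q'" "p * q' - p' * q"] x(2) y(2) by simp
  moreover have sum: "n \<le> 2 * (a + b + (c + d))"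
    if "n \<le> k + l" "k \<le> i + j" "i \<le> a + d" "j \<le> c + b" "l \<le> b + d" for n k l i j a b c d :: nat
    using that by simp
  ultimately show ?thesis
    unfolding x(3) y(3) by (intro sum[OF _ int_bits_diff int_bits_mult int_bits_mult int_bits_mult])
qed

lemma real_bits_mult:
  assumes "x \<in> \<rat>" "y \<in> \<rat>"
  shows "real_bits (x * y) \<le> real_bits x + real_bits y"
proof -
  obtain p q where x: "x = of_int p / of_int q" "q \<noteq> 0" "real_bits x = int_bits p + int_bits q"
    using assms(1) by (rule rational_fraction)
  obtain p' q' where y: "y = of_int p' / of_int q'" "q' \<noteq> 0" "real_bits y = int_bits p' + int_bits q'"
    using assms(2) by (rule rational_fraction)
  have "real_bits (x * y) \<le> int_bits (p * p') + int_bits (q * q')"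
    using real_bits_fraction_le[of "q * q'" "p * p'"] x(2) y(2) by (simp add: x(1) y(1))
  then show ?thesis
    using int_bits_mult[of p p'] int_bits_mult[of q q'] x(3) y(3) by linarith
qed

lemma real_bits_uminus:
  assumes "x \<in> \<rat>"
  shows "real_bits (- x) \<le> real_bits x"
proof -
  obtain p q where x: "x = of_int p / of_int q" "q \<noteq> 0" "real_bits x = int_bits p + int_bits q"
    using assms by (rule rational_fraction)
  then show ?thesis
    using real_bits_fraction_le[of q "- p"] by (simp add: int_bits_def)
qed

lemma int_bits_0_1: "int_bits 0 = 2" "int_bits 1 = 3"
proof -
  have "floorlog 2 (Suc 0) = Suc 0" by (simp add: floorlog_def)
  then show "int_bits 0 = 2" "int_bits 1 = 3"
    by (simp_all add: int_bits_def nat_bits_def floorlog_eq_zero_iff)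
qed

lemma real_bits_0: "real_bits 0 \<le> 5"
  using real_bits_fraction_le[of 1 0] by (simp add: int_bits_0_1)

lemma real_bits_of_nat: "real_bits (real n) \<le> n + 5"
  using real_bits_fraction_le[of 1 "int n"] nat_bits_le_Suc[of n] int_bits_0_1(2)
  by (simp add: int_bits_def)

section \<open>Polynomially bounded quantities\<close>

text \<open>Unlike \<open>polynomial_time\<close>, this speaks of a single quantity and is closed under sums, products and
  composition with polynomials. Bounds over \<open>nat\<close> suit composition since such polynomials are monotone.\<close>

definition poly_bounded :: "('a \<Rightarrow> bool) \<Rightarrow> ('a \<Rightarrow> nat) \<Rightarrow> ('a \<Rightarrow> nat) \<Rightarrow> bool" where
  "poly_bounded P sz q \<longleftrightarrow> (\<exists>p :: nat poly. \<forall>x. P x \<longrightarrow> q x \<le> poly p (sz x))"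

lemma poly_nat_mono: "m \<le> n \<Longrightarrow> poly p m \<le> poly (p :: nat poly) n"
  by (induction p) (auto intro!: add_mono mult_mono)

lemma poly_bounded_mono:
  "poly_bounded P sz q \<Longrightarrow> (\<And>x. P x \<Longrightarrow> q' x \<le> q x) \<Longrightarrow> poly_bounded P sz q'"
  unfolding poly_bounded_def by (meson le_trans)

lemma poly_bounded_const: "poly_bounded P sz (\<lambda>x. c)"
  unfolding poly_bounded_def by (rule exI[of _ "[:c:]"]) simp

lemma poly_bounded_size: "poly_bounded P sz sz"
  unfolding poly_bounded_def by (rule exI[of _ "[:0, 1:]"]) simp

lemma poly_bounded_add:
  assumes "poly_bounded P sz q" "poly_bounded P sz q'"
  shows "poly_bounded P sz (\<lambda>x. q x + q' x)"
proof -
  obtain p p' where "\<forall>x. P x \<longrightarrow> q x \<le> poly p (sz x)" "\<forall>x. P x \<longrightarrow> q' x \<le> poly p' (sz x)"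
    using assms by (auto simp: poly_bounded_def)
  then show ?thesis
    unfolding poly_bounded_def by (intro exI[of _ "p + p'"]) (auto intro: add_mono)
qed

lemma poly_bounded_mult:
  assumes "poly_bounded P sz q" "poly_bounded P sz q'"
  shows "poly_bounded P sz (\<lambda>x. q x * q' x)"
proof -
  obtain p p' where "\<forall>x. P x \<longrightarrow> q x \<le> poly p (sz x)" "\<forall>x. P x \<longrightarrow> q' x \<le> poly p' (sz x)"
    using assms by (auto simp: poly_bounded_def)
  then show ?thesis
    unfolding poly_bounded_def by (intro exI[of _ "p * p'"]) (auto intro: mult_mono)
qed

lemma poly_bounded_poly:
  assumes "poly_bounded P sz q"
  shows "poly_bounded P sz (\<lambda>x. poly r (q x))"
proof -
  obtain p where "\<forall>x. P x \<longrightarrow> q x \<le> poly p (sz x)"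
    using assms by (auto simp: poly_bounded_def)
  then show ?thesis
    unfolding poly_bounded_def by (intro exI[of _ "pcompose r p"]) (auto simp: poly_pcompose poly_nat_mono)
qed

lemma poly_bounded_Suc: "poly_bounded P sz q \<Longrightarrow> poly_bounded P sz (\<lambda>x. Suc (q x))"
  using poly_bounded_add[OF _ poly_bounded_const[of _ _ 1]] by simp

lemma poly_bounded_power: "poly_bounded P sz q \<Longrightarrow> poly_bounded P sz (\<lambda>x. q x ^ k)"
  by (induction k) (auto intro: poly_bounded_const poly_bounded_mult)

lemma poly_bounded_map_timed:
  assumes "poly_bounded P sz (\<lambda>x. length (xs x))" "poly_bounded P sz c"
    and "\<And>x y. P x \<Longrightarrow> y \<in> set (xs x) \<Longrightarrow> snd (f x y) \<le> c x"
  shows "poly_bounded P sz (\<lambda>x. snd (map_timed (f x) (xs x)))"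
proof (rule poly_bounded_mono)
  show "poly_bounded P sz (\<lambda>x. Suc (length (xs x) * Suc (c x)))"
    by (intro poly_bounded_Suc poly_bounded_mult assms)
  show "snd (map_timed (f x) (xs x)) \<le> Suc (length (xs x) * Suc (c x))" if "P x" for x
    by (rule snd_map_timed_le) (rule assms(3)[OF that])
qed

lemmas poly_bounded_intros =
  poly_bounded_const poly_bounded_size poly_bounded_add poly_bounded_mult poly_bounded_Suc
  poly_bounded_power poly_bounded_poly

section \<open>Quantities bounded by the input size\<close>

abbreviation (input) rational_instance :: "'l dispatch \<Rightarrow> bool" where
  "rational_instance X \<equiv> valid_dispatch X \<and> rational_dispatch X"

lemma length_le_sum_list: "(\<And>x. x \<in> set xs \<Longrightarrow> 1 \<le> f x) \<Longrightarrow> length xs \<le> (\<Sum>x\<leftarrow>xs. f x :: nat)"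
proof (induction xs)
  case (Cons x xs)
  then have "1 + length xs \<le> f x + (\<Sum>x\<leftarrow>xs. f x)" by (intro add_mono) auto
  then show ?case by simp
qed simp

lemma length_locs_le: "length (locs X) \<le> input_size X"
proof -
  have "length (locs X) * 1 \<le> length (locs X) * nat_bits (length (locs X))"
    by (intro mult_le_mono2 nat_bits_pos)
  then show ?thesis unfolding input_size_def by linarith
qed

lemma length_slots_le:
  assumes "valid_dispatch X"
  shows "length (slots X) \<le> input_size X"
proof -
  have "length (slots X) = (\<Sum>t\<in>set (slots X). 1)"
    using assms by (simp add: valid_dispatch_def distinct_card)
  also have "\<dots> \<le> (\<Sum>t\<in>set (slots X). int_bits t)"
    by (rule sum_mono) (simp add: int_bits_def)
  finally show ?thesis by (simp add: input_size_def)
qed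

lemma length_orders_le: "length (orders X) \<le> input_size X"
proof -
  have "length (orders X) \<le> (\<Sum>(s, s', v)\<leftarrow>orders X. state_bits X s + state_bits X s' + real_bits v)"
    by (rule length_le_sum_list) (auto simp: state_bits_def nat_bits_def)
  then show ?thesis by (simp add: input_size_def)
qed

lemma real_bits_cost_le:
  assumes "(s, s') \<in> admissible X"
  shows "real_bits (cost X s s') \<le> input_size X"
proof -
  have "real_bits (cost X s s') \<le> (\<Sum>(s, s')\<in>admissible X. real_bits (cost X s s'))"
    using member_le_sum[OF assms, of "\<lambda>(s, s'). real_bits (cost X s s')"] by simp
  then show ?thesis by (simp add: input_size_def)
qed

lemma nat_bits_drivers_le:
  assumes "s \<in> states X"
  shows "nat_bits (drivers X s) \<le> input_size X"
  using member_le_sum[OF assms, of "\<lambda>s. nat_bits (drivers X s)"] by (simp add: input_size_def)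

lemma real_bits_valuation_le:
  assumes "v \<in> set (valuations X s s')"
  shows "real_bits v \<le> input_size X"
proof -
  obtain a b where "(a, b, v) \<in> set (orders X)"
    using assms by (auto simp: valuations_def)
  then have "state_bits X a + state_bits X b + real_bits v
      \<in> set (map (\<lambda>(s, s', v). state_bits X s + state_bits X s' + real_bits v) (orders X))"
    by (auto simp: image_iff intro!: bexI[of _ "(a, b, v)"])
  from member_le_sum_list[OF this]
  have "real_bits v \<le> (\<Sum>(s, s', v)\<leftarrow>orders X. state_bits X s + state_bits X s' + real_bits v)"
    by simp
  then show ?thesis by (simp add: input_size_def)
qed

lemma num_orders_le: "num_orders X s s' \<le> input_size X"
  unfolding num_orders_def valuations_def length_map
  by (rule order.trans[OF length_filter_le length_orders_le])

lemma rational_valuation: "rational_dispatch X \<Longrightarrow> v \<in> set (valuations X s s') \<Longrightarrow> v \<in> \<rat>"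
  by (auto simp: rational_dispatch_def valuations_def)

lemma rational_cost: "rational_dispatch X \<Longrightarrow> (s, s') \<in> admissible X \<Longrightarrow> cost X s s' \<in> \<rat>"
  by (auto simp: rational_dispatch_def)

lemma length_state_list_le:
  "valid_dispatch X \<Longrightarrow> length (state_list X) \<le> input_size X * input_size X"
  by (simp add: state_list_def length_product mult_le_mono length_locs_le length_slots_le)

lemma length_admissible_list_le:
  "length (admissible_list X) \<le> length (state_list X) * length (state_list X)"
  unfolding admissible_list_def by (rule order.trans[OF length_filter_le]) (simp add: length_product)

section \<open>Running times of the steps\<close>

lemma snd_insert_desc_le:
  assumes "real_bits x \<le> m" "\<forall>y\<in>set ys. real_bits y \<le> m"
  shows "snd (insert_desc x ys) \<le> Suc (length ys * Suc ((2 * m)\<^sup>2))"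
  using assms(2)
proof (induction ys)
  case (Cons y ys)
  have "(real_bits x + real_bits y)\<^sup>2 \<le> (2 * m)\<^sup>2"
    using assms(1) Cons.prems by (intro power_mono) auto
  with Cons show ?case by auto
qed simp

lemma snd_sort_desc_le:
  assumes "\<forall>x\<in>set xs. real_bits x \<le> m"
  shows "snd (sort_desc xs) \<le> Suc (length xs * Suc (length xs * Suc ((2 * m)\<^sup>2)))"
  using assms
proof (induction xs)
  case (Cons x xs)
  let ?c = "Suc ((2 * m)\<^sup>2)"
  have "snd (sort_desc (x # xs)) \<le> Suc (length xs * Suc (length xs * ?c)) + Suc (length xs * ?c)"
    using Cons snd_insert_desc_le[of x m "fst (sort_desc xs)"] by (auto intro: add_mono)
  also have "\<dots> \<le> Suc (length (x # xs) * Suc (length (x # xs) * ?c))"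
    by (simp add: algebra_simps)
  finally show ?case .
qed simp

lemma snd_sorted_valuations_le:
  fixes X :: "'l dispatch" and s s' :: "'l state"
  defines "m \<equiv> input_size X"
  shows "snd (sorted_valuations X s s')
    \<le> Suc (m * (m + 2)) + (Suc (m * (m + 2)) + Suc (m * Suc (m * Suc ((2 * m)\<^sup>2))))"
proof -
  let ?os = "filter (\<lambda>(a, b, v). a = s \<and> b = s') (orders X)"
  let ?vs = "valuations X s s'"
  have len: "length ?vs \<le> m" "length ?os \<le> m"
    using num_orders_le[of X s s'] by (simp_all add: num_orders_def valuations_def m_def)
  have split: "snd (sorted_valuations X s s')
      = snd (filter_timed (\<lambda>(a, b, v). scan X (a = s \<and> b = s')) (orders X))
        + (snd (map_timed (\<lambda>(a, b, v). scan X v) ?os) + snd (sort_desc ?vs))"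
    by (simp add: sorted_valuations_def valuations_def case_prod_unfold)
  have "snd (filter_timed (\<lambda>(a, b, v). scan X (a = s \<and> b = s')) (orders X))
      \<le> Suc (length (orders X) * Suc (Suc m))"
    by (rule snd_filter_timed_le) (auto simp: m_def)
  also have "\<dots> \<le> Suc (m * (m + 2))"
    using mult_le_mono1[OF length_orders_le[of X], of "m + 2"] by (simp add: m_def)
  finally have 1: "snd (filter_timed (\<lambda>(a, b, v). scan X (a = s \<and> b = s')) (orders X))
      \<le> Suc (m * (m + 2))" .
  have "snd (map_timed (\<lambda>(a, b, v). scan X v) ?os) \<le> Suc (length ?os * Suc (Suc m))"
    by (rule snd_map_timed_le) (auto simp: m_def)
  also have "\<dots> \<le> Suc (m * (m + 2))"
    using mult_le_mono1[OF len(2), of "m + 2"] by simp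
  finally have 2: "snd (map_timed (\<lambda>(a, b, v). scan X v) ?os) \<le> Suc (m * (m + 2))" .
  have "snd (sort_desc ?vs) \<le> Suc (length ?vs * Suc (length ?vs * Suc ((2 * m)\<^sup>2)))"
    by (rule snd_sort_desc_le) (simp add: real_bits_valuation_le m_def)
  also have "\<dots> \<le> Suc (m * Suc (m * Suc ((2 * m)\<^sup>2)))"
    using len(1) by (intro Suc_le_mono[THEN iffD2] mult_le_mono) auto
  finally show ?thesis using 1 2 unfolding split by (intro add_mono)
qed

text \<open>The numbers computed in the construction do not depend on each other through a long chain:
  a reward is obtained directly from one valuation, a cost and an index.\<close>

lemma real_bits_partial_reward:
  assumes "v \<in> \<rat>" "c \<in> \<rat>" "real_bits v \<le> m" "real_bits c \<le> m" "i \<le> m"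
  shows "real_bits (v - c) \<le> 4 * m" "real_bits ((v - c) * real i) \<le> 5 * m + 5"
proof -
  show d: "real_bits (v - c) \<le> 4 * m"
    using real_bits_diff[OF assms(1,2)] assms(3,4) by simp
  have "real_bits ((v - c) * real i) \<le> real_bits (v - c) + real_bits (real i)"
    using assms(1,2) by (intro real_bits_mult) auto
  then show "real_bits ((v - c) * real i) \<le> 5 * m + 5"
    using d real_bits_of_nat[of i] assms(5) by linarith
qed

text \<open>Three arithmetic operations on numbers of total length at most \<open>10 * m + 10\<close>, the increment of the
  index \<open>i \<le> m\<close>, the output of a weight of length at most \<open>20 * m + 20\<close>, and a scan.\<close>

definition unit_arc_time :: "nat \<Rightarrow> nat" where
  "unit_arc_time m = 3 * (10 * m + 10)\<^sup>2 + (m + 1) + (20 * m + 20) + Suc m"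

text \<open>Since the accumulator is replaced rather than added to, the bound on its length is invariant and
  lengths do not grow along the recursion.\<close>

lemma snd_unit_arcs_le:
  fixes X :: "'l dispatch" and s s' :: "'l state"
  defines "m \<equiv> input_size X"
  assumes "cost X s s' \<in> \<rat>" "real_bits (cost X s s') \<le> m"
    and "\<forall>v\<in>set vs. v \<in> \<rat> \<and> real_bits v \<le> m"
    and "r \<in> \<rat>" "real_bits r \<le> 5 * m + 5" "i + length vs \<le> Suc m"
  shows "snd (unit_arcs X s s' r i vs) \<le> Suc (length vs * unit_arc_time m)"
  using assms(4-7)
proof (induction vs arbitrary: r i)
  case (Cons v vs)
  let ?c = "cost X s s'"
  define d where "d = v - ?c"
  define r' where "r' = d * real i"
  define w where "w = r' - r"
  have v: "v \<in> \<rat>" "real_bits v \<le> m" and i: "i \<le> m"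
    using Cons.prems by auto
  have rat: "d \<in> \<rat>" "r' \<in> \<rat>"
    using v(1) assms(2) by (auto simp: d_def r'_def)
  have d: "real_bits d \<le> 4 * m" and r': "real_bits r' \<le> 5 * m + 5"
    unfolding d_def r'_def using real_bits_partial_reward[OF v(1) assms(2) v(2) assms(3) i] by auto
  have w: "real_bits w \<le> 20 * m + 20"
    unfolding w_def using real_bits_diff[OF rat(2) Cons.prems(2)] r' Cons.prems(3) by simp
  have sq: "(real_bits x + real_bits y)\<^sup>2 \<le> (10 * m + 10)\<^sup>2"
    if "real_bits x + real_bits y \<le> 10 * m + 10" for x y
    using that by (intro power_mono) auto
  have "(real_bits v + real_bits ?c)\<^sup>2 \<le> (10 * m + 10)\<^sup>2"
    by (rule sq) (use v assms(3) in linarith)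
  moreover have "(real_bits d + real_bits (real i))\<^sup>2 \<le> (10 * m + 10)\<^sup>2"
    by (rule sq) (use d real_bits_of_nat[of i] i in linarith)
  moreover have "(real_bits r' + real_bits r)\<^sup>2 \<le> (10 * m + 10)\<^sup>2"
    by (rule sq) (use r' Cons.prems(3) in linarith)
  moreover have "nat_bits i \<le> m + 1"
    using nat_bits_le_Suc[of i] i by linarith
  moreover have "snd (unit_arcs X s s' r' (Suc i) vs) \<le> Suc (length vs * unit_arc_time m)"
    by (rule Cons.IH) (use Cons.prems r' rat in auto)
  moreover have "snd (unit_arcs X s s' r i (v # vs))
      = (real_bits v + real_bits ?c)\<^sup>2 + (real_bits d + real_bits (real i))\<^sup>2
        + (real_bits r' + real_bits r)\<^sup>2 + nat_bits i + real_bits w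
        + snd (unit_arcs X s s' r' (Suc i) vs) + Suc m"
    by (simp add: d_def[symmetric] r'_def[symmetric] w_def[symmetric] m_def)
  ultimately have "snd (unit_arcs X s s' r i (v # vs)) \<le> Suc (length vs * unit_arc_time m) + unit_arc_time m"
    using w unfolding unit_arc_time_def by linarith
  then show ?case by simp
qed simp

definition decomposed_arcs_time :: "nat \<Rightarrow> nat" where
  "decomposed_arcs_time m = Suc (m * (m + 2)) + (Suc (m * (m + 2)) + Suc (m * Suc (m * Suc ((2 * m)\<^sup>2))))
     + Suc (m * unit_arc_time m)"

lemma snd_decomposed_arcs_le:
  assumes X: "rational_instance X" and q: "q \<in> admissible X"
  shows "snd (decomposed_arcs X q) \<le> decomposed_arcs_time (input_size X)"
proof -
  obtain s s' where q': "q = (s, s')" by (rule prod.exhaust)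
  let ?m = "input_size X" and ?vs = "rev (sort (valuations X s s'))"
  have "snd (unit_arcs X s s' 0 1 ?vs) \<le> Suc (length ?vs * unit_arc_time ?m)"
  proof (rule snd_unit_arcs_le)
    show "1 + length ?vs \<le> Suc ?m"
      using num_orders_le[of X s s'] by (simp add: num_orders_def)
    show "real_bits 0 \<le> 5 * ?m + 5" using real_bits_0 by simp
  qed (use X q q' in \<open>auto simp: rational_cost real_bits_cost_le rational_valuation real_bits_valuation_le\<close>)
  also have "\<dots> \<le> Suc (?m * unit_arc_time ?m)"
    using num_orders_le[of X s s'] by (simp add: num_orders_def)
  finally show ?thesis
    using snd_sorted_valuations_le[of X s s']
    by (simp add: decomposed_arcs_def q' decomposed_arcs_time_def)
qed

lemma marginal_reward_bits:
  assumes X: "rational_instance X" and q: "(s, s') \<in> admissible X"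
    and i: "i \<in> {1..num_orders X s s'}"
  shows "marginal_reward X s s' i \<in> \<rat>" "real_bits (- marginal_reward X s s' i) \<le> 20 * input_size X + 20"
proof -
  let ?m = "input_size X"
  have reward: "reward X k (E_w s s') \<in> \<rat> \<and> real_bits (reward X k (E_w s s')) \<le> 5 * ?m + 5"
    if "k \<le> num_orders X s s'" for k
  proof (cases "k = 0")
    case True
    then show ?thesis using real_bits_0 by simp
  next
    case False
    have "rev (sort (valuations X s s')) ! (k - 1) \<in> set (rev (sort (valuations X s s')))"
      using False that by (intro nth_mem) (simp add: num_orders_def)
    then have v: "kth_valuation X s s' k \<in> set (valuations X s s')"
      by (simp add: kth_valuation_def)
    have "k \<le> ?m" using that num_orders_le[of X s s'] by simp
    then have "real_bits ((kth_valuation X s s' k - cost X s s') * real k) \<le> 5 * ?m + 5"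
      using X v q by (intro real_bits_partial_reward rational_valuation[of X _ s s'] rational_cost
          real_bits_valuation_le[of _ X s s'] real_bits_cost_le) auto
    then show ?thesis
      using False X v q rational_valuation[of X _ s s'] rational_cost[of X s s'] by auto
  qed
  have 1: "reward X i (E_w s s') \<in> \<rat> \<and> real_bits (reward X i (E_w s s')) \<le> 5 * ?m + 5"
    using i by (intro reward) simp
  have 2: "reward X (i - 1) (E_w s s') \<in> \<rat> \<and> real_bits (reward X (i - 1) (E_w s s')) \<le> 5 * ?m + 5"
    using i by (intro reward) (simp add: diff_le_mono le_diff_conv)
  show rat: "marginal_reward X s s' i \<in> \<rat>"
    unfolding marginal_reward_def using 1 2 by (intro Rats_diff) auto
  have "real_bits (- marginal_reward X s s' i) \<le> real_bits (marginal_reward X s s' i)"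
    by (rule real_bits_uminus[OF rat])
  also have "\<dots> \<le> 2 * (real_bits (reward X i (E_w s s')) + real_bits (reward X (i - 1) (E_w s s')))"
    unfolding marginal_reward_def using 1 2 by (intro real_bits_diff) auto
  finally show "real_bits (- marginal_reward X s s' i) \<le> 20 * input_size X + 20"
    using 1 2 by simp
qed

lemma kept_weight_bits:
  assumes "rational_instance X" "e \<in> arcs (dispatch_graph X)"
  shows "kept_weight X e \<in> \<rat>" "real_bits (- kept_weight X e) \<le> input_size X + 5"
proof -
  have "kept_weight X e \<in> \<rat> \<and> real_bits (- kept_weight X e) \<le> input_size X + 5"
  proof (cases e)
    case (E_o s s')
    then have "(s, s') \<in> admissible X" using assms(2) by (auto simp: arcs_dispatch_graph)
    then show ?thesis
      using E_o assms(1) rational_cost[of X s s'] real_bits_cost_le[of s s' X] by simp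
  qed (use real_bits_0 in auto)
  then show "kept_weight X e \<in> \<rat>" "real_bits (- kept_weight X e) \<le> input_size X + 5" by auto
qed

lemma rational_split_network:
  assumes "rational_instance X"
  shows "rational_network (split_network X)"
proof -
  have "split_cost X x \<in> \<rat>" if "x \<in> set (split_edges X)" for x
  proof (cases x)
    case (Unit s s' i)
    then show ?thesis using that marginal_reward_bits(1)[OF assms, of s s' i] by simp
  next
    case (Kept e)
    then show ?thesis using that kept_weight_bits(1)[OF assms, of e] by simp
  qed
  then show ?thesis by (auto simp: rational_network_def split_network_def)
qed

lemma length_linear_edges:
  "length (linear_edges X) = Suc (2 * length (state_list X) + length (admissible_list X))"
  by (simp add: linear_edges_def)

lemma length_unit_edges_le: "length (unit_edges X) \<le> length (admissible_list X) * input_size X"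
proof -
  have "length (concat (map (\<lambda>(s, s'). map (Unit s s') [1..<Suc (num_orders X s s')]) qs))
      \<le> length qs * input_size X" for qs
  proof (induction qs)
    case (Cons q qs)
    obtain s s' where "q = (s, s')" by (rule prod.exhaust)
    then show ?case using add_mono[OF num_orders_le[of X s s'] Cons.IH] by (simp del: upt_Suc)
  qed simp
  then show ?thesis by (simp add: unit_edges_def)
qed

lemma split_arc_bits_le:
  assumes X: "rational_instance X" and x: "x \<in> set (split_edges X)"
  shows "nat_bits (split_lower X x) + enat_bits (split_upper X x) + real_bits (split_cost X x)
    \<le> 22 * input_size X + 30"
proof (cases x)
  case (Unit s s' i)
  then show ?thesis
    using x marginal_reward_bits(2)[OF X, of s s' i] nat_bits_le_Suc[of 0] nat_bits_le_Suc[of 1]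
    by (simp add: enat_bits_def one_enat_def)
next
  case (Kept e)
  then have e: "e \<in> arcs (dispatch_graph X)" "\<And>s s'. e \<noteq> E_w s s'"
    using x by auto
  have "nat_bits (lower X e) + enat_bits (upper X e) \<le> 2 * input_size X + 2"
  proof (cases e)
    case (E_I s)
    then show ?thesis
      using e(1) nat_bits_drivers_le[of s X] by (auto simp: arcs_dispatch_graph enat_bits_def)
  qed (use e nat_bits_le_Suc[of 0] in \<open>auto simp: enat_bits_def\<close>)
  then show ?thesis using kept_weight_bits(2)[OF X e(1)] by (simp add: Kept)
qed

lemma flow_list_size_simps [simp]:
  "flow_list_size [] = 0" "flow_list_size (k # ks) = nat_bits k + flow_list_size ks"
  by (simp_all add: flow_list_size_def)

lemma length_le_flow_list_size: "length ks \<le> flow_list_size ks"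
  unfolding flow_list_size_def by (rule length_le_sum_list) (rule nat_bits_pos)

lemma nat_bits_sum_list_le: "nat_bits (sum_list ks) \<le> Suc (flow_list_size ks)"
proof (induction ks)
  case Nil
  then show ?case using nat_bits_le_Suc[of 0] by simp
next
  case (Cons k ks)
  then show ?case using nat_bits_add[of k "sum_list ks"] by simp
qed

lemma snd_sum_timed_le: "snd (sum_timed ks) \<le> Suc (length ks * Suc (flow_list_size ks))"
proof (induction ks)
  case (Cons k ks)
  have "snd (sum_timed (k # ks)) \<le> Suc (length ks * Suc (flow_list_size ks)) + Suc (flow_list_size (k # ks))"
    using Cons nat_bits_sum_list_le[of ks] by simp
  also have "\<dots> \<le> Suc (length ks * Suc (flow_list_size (k # ks))) + Suc (flow_list_size (k # ks))"
    by (intro add_mono Suc_le_mono[THEN iffD2] mult_le_mono) auto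
  finally show ?case by simp
qed simp

text \<open>\<open>F\<close> is the length of the flow that the solver returns; it bounds the number of table entries and,
  up to one, the lengths of all partial sums.\<close>

definition recombine_time :: "nat \<Rightarrow> nat \<Rightarrow> nat" where
  "recombine_time m F = Suc (F * (m + 2)) + Suc (F * Suc F) + Suc (F * Suc F) + Suc F"

lemma recombine_cost:
  assumes F: "flow_list_size (map snd tab) \<le> F"
  shows "fst (recombine X tab e) = (e, \<Sum>(x, k)\<leftarrow>filter (\<lambda>(x, k). origin x = e) tab. k)"
    and "snd (recombine X tab e) \<le> recombine_time (input_size X) F"
    and "nat_bits (snd (fst (recombine X tab e))) \<le> snd (recombine X tab e)"
proof -
  let ?en = "filter (\<lambda>(x, k). origin x = e) tab"
  let ?ks = "map (\<lambda>(x, k). k) ?en"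
  show fst_eq: "fst (recombine X tab e) = (e, \<Sum>(x, k)\<leftarrow>filter (\<lambda>(x, k). origin x = e) tab. k)"
    by (simp add: recombine_def case_prod_unfold)
  have split: "snd (recombine X tab e)
      = snd (filter_timed (\<lambda>(e', k). scan X (origin e' = e)) tab)
        + (snd (map_timed (\<lambda>(e', k). charge (nat_bits k) k) ?en)
        + (snd (sum_timed ?ks) + nat_bits (sum_list ?ks)))"
    by (simp add: recombine_def case_prod_unfold)
  show "nat_bits (snd (fst (recombine X tab e))) \<le> snd (recombine X tab e)"
    unfolding fst_eq split by simp
  have ks_size: "flow_list_size ?ks \<le> F"
  proof -
    have "flow_list_size (map (\<lambda>(x, k). k) (filter P tab)) \<le> flow_list_size (map snd tab)" for P
      by (induction tab) auto
    then show ?thesis using F le_trans by blast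
  qed
  then have ks_len: "length ?ks \<le> F" "length ?en \<le> F"
    using length_le_flow_list_size[of ?ks] by auto
  have tab_len: "length tab \<le> F"
    using length_le_flow_list_size[of "map snd tab"] F by simp
  have "snd (filter_timed (\<lambda>(e', k). scan X (origin e' = e)) tab)
      \<le> Suc (length tab * Suc (Suc (input_size X)))"
    by (rule snd_filter_timed_le) auto
  also have "\<dots> \<le> Suc (F * (input_size X + 2))"
    using mult_le_mono1[OF tab_len, of "input_size X + 2"] by simp
  finally have 1: "snd (filter_timed (\<lambda>(e', k). scan X (origin e' = e)) tab)
      \<le> Suc (F * (input_size X + 2))" .
  have "nat_bits k \<le> F" if "(x, k) \<in> set ?en" for x k
  proof -
    have "k \<in> set (map snd tab)" using that by force
    then have "nat_bits k \<le> flow_list_size (map snd tab)"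
      unfolding flow_list_size_def by (intro member_le_sum_list) auto
    then show ?thesis using F by simp
  qed
  then have "snd (map_timed (\<lambda>(e', k). charge (nat_bits k) k) ?en) \<le> Suc (length ?en * Suc F)"
    by (intro snd_map_timed_le) auto
  also have "\<dots> \<le> Suc (F * Suc F)"
    using mult_le_mono1[OF ks_len(2), of "Suc F"] by simp
  finally have 2: "snd (map_timed (\<lambda>(e', k). charge (nat_bits k) k) ?en) \<le> Suc (F * Suc F)" .
  have "snd (sum_timed ?ks) \<le> Suc (length ?ks * Suc (flow_list_size ?ks))"
    by (rule snd_sum_timed_le)
  also have "\<dots> \<le> Suc (F * Suc F)"
    using ks_len(1) ks_size by (intro Suc_le_mono[THEN iffD2] mult_le_mono) auto
  finally have 3: "snd (sum_timed ?ks) \<le> Suc (F * Suc F)" .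
  have 4: "nat_bits (sum_list ?ks) \<le> Suc F"
    using nat_bits_sum_list_le[of ?ks] ks_size by linarith
  show "snd (recombine X tab e) \<le> recombine_time (input_size X) F"
    unfolding split recombine_time_def using 1 2 3 4 by linarith
qed

section \<open>Running time of the algorithm\<close>

lemma network_size_split_network_le:
  fixes X :: "'l dispatch"
  assumes "rational_instance X"
  defines "V \<equiv> length (state_list X) + 2"
  shows "network_size (split_network X)
    \<le> V + length (split_edges X) * (2 * Suc V + (22 * input_size X + 30))"
proof -
  let ?size = "\<lambda>a :: 'l vertex lin_arc. 2 * nat_bits V + nat_bits (arc_lower a) + enat_bits (arc_upper a)
     + real_bits (arc_cost a)"
  have "(\<Sum>x\<leftarrow>split_edges X. ?size (split_arc X x))
      \<le> (\<Sum>x\<leftarrow>split_edges X. 2 * Suc V + (22 * input_size X + 30))"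
  proof (rule sum_list_mono)
    fix x assume "x \<in> set (split_edges X)"
    then show "?size (split_arc X x) \<le> 2 * Suc V + (22 * input_size X + 30)"
      using split_arc_bits_le[OF assms(1), of x] nat_bits_le_Suc[of V] by simp
  qed
  then show ?thesis
    by (simp add: network_size_def split_network_def V_def o_def sum_list_triv)
qed

abbreviation poly_in_input :: "('l dispatch \<Rightarrow> nat) \<Rightarrow> bool" where
  "poly_in_input \<equiv> poly_bounded rational_instance input_size"

lemma poly_bounded_lengths:
  shows "poly_in_input (\<lambda>X. length (locs X))"
    and "poly_in_input (\<lambda>X. length (slots X))"
    and "poly_in_input (\<lambda>X. length (state_list X))"
    and "poly_in_input (\<lambda>X. length (admissible_list X))"
    and "poly_in_input (\<lambda>X. length (linear_edges X))"
    and "poly_in_input (\<lambda>X. length (unit_edges X))"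
    and "poly_in_input (\<lambda>X. length (split_edges X))"
    and "poly_in_input (\<lambda>X. length (all_edges X))"
proof -
  show "poly_in_input (\<lambda>X. length (locs X))"
    by (rule poly_bounded_mono[OF poly_bounded_size]) (rule length_locs_le)
  show "poly_in_input (\<lambda>X. length (slots X))"
    by (rule poly_bounded_mono[OF poly_bounded_size]) (simp add: length_slots_le)
  show S: "poly_in_input (\<lambda>X. length (state_list X))"
    by (rule poly_bounded_mono[of _ _ "\<lambda>X. input_size X * input_size X"])
      (auto intro: poly_bounded_intros length_state_list_le)
  show Q: "poly_in_input (\<lambda>X. length (admissible_list X))"
    by (rule poly_bounded_mono[OF poly_bounded_mult[OF S S]]) (rule length_admissible_list_le)
  show L: "poly_in_input (\<lambda>X. length (linear_edges X))"
    unfolding length_linear_edges by (intro poly_bounded_intros S Q)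
  show U: "poly_in_input (\<lambda>X. length (unit_edges X))"
    by (rule poly_bounded_mono[OF poly_bounded_mult[OF Q poly_bounded_size]]) (rule length_unit_edges_le)
  show "poly_in_input (\<lambda>X. length (split_edges X))"
    unfolding split_edges_def length_append length_map by (intro poly_bounded_intros U L)
  show "poly_in_input (\<lambda>X. length (all_edges X))"
    unfolding all_edges_def length_append length_map by (intro poly_bounded_intros Q L)
qed

lemma poly_bounded_list_states: "poly_in_input (\<lambda>X. snd (list_states X))"
proof -
  have "concat (map (\<lambda>l. map (Pair l) (slots X)) (locs X)) = state_list X" for X :: "'a dispatch"
    using fst_list_states[of X] by (simp add: list_states_def)
  then have "snd (list_states X)
      = snd (map_timed (\<lambda>l. map_timed (\<lambda>t. scan X (l, t)) (slots X)) (locs X))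
        + Suc (length (locs X) + length (state_list X))" for X :: "'a dispatch"
    by (simp add: list_states_def)
  moreover have "poly_in_input
      (\<lambda>X. snd (map_timed (\<lambda>l. map_timed (\<lambda>t. scan X (l, t)) (slots X)) (locs X)))"
  proof (rule poly_bounded_map_timed[where c = "\<lambda>X. Suc (length (slots X) * (input_size X + 2))"])
    show "poly_in_input (\<lambda>X. Suc (length (slots X) * (input_size X + 2)))"
      by (intro poly_bounded_intros poly_bounded_lengths)
  qed (simp_all add: poly_bounded_lengths)
  ultimately show ?thesis
    by (simp only:) (intro poly_bounded_intros poly_bounded_lengths)
qed

lemma poly_bounded_list_admissible:
  "poly_in_input (\<lambda>X. snd (list_admissible X (state_list X)))"
proof -
  let ?row = "\<lambda>X s. bind_timed (filter_timed (\<lambda>s'. scan X (reaches X s s')) (state_list X))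
     (map_timed (\<lambda>s'. scan X (s, s')))"
  have "concat (map (\<lambda>s. map (Pair s) (filter (reaches X s) (state_list X))) (state_list X))
      = admissible_list X" for X :: "'a dispatch"
    using fst_list_admissible[of X] by (simp add: list_admissible_def)
  then have "snd (list_admissible X (state_list X))
      = snd (map_timed (?row X) (state_list X))
        + Suc (length (state_list X) + length (admissible_list X))" for X :: "'a dispatch"
    by (simp add: list_admissible_def)
  moreover have "poly_in_input (\<lambda>X :: 'a dispatch. snd (map_timed (?row X) (state_list X)))"
  proof (rule poly_bounded_map_timed)
    let ?c = "\<lambda>X. Suc (length (state_list X) * (input_size X + 2))
      + Suc (length (state_list X) * (input_size X + 2))"
    show "poly_in_input ?c"
      by (intro poly_bounded_intros poly_bounded_lengths)
    fix X :: "'a dispatch" and s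
    have "snd (filter_timed (\<lambda>s'. scan X (reaches X s s')) (state_list X))
        \<le> Suc (length (state_list X) * Suc (Suc (input_size X)))"
      by (rule snd_filter_timed_le) simp
    moreover have "length (filter (reaches X s) (state_list X)) * (input_size X + 2)
        \<le> length (state_list X) * (input_size X + 2)"
      by (intro mult_le_mono1 length_filter_le)
    ultimately show "snd (?row X s) \<le> ?c X" by simp
  qed (rule poly_bounded_lengths)
  ultimately show ?thesis
    by (simp only:) (intro poly_bounded_intros poly_bounded_lengths)
qed

lemma poly_bounded_map_scan_pairs:
  assumes "poly_in_input (\<lambda>X. length (qs X))"
  shows "poly_in_input (\<lambda>X. snd (map_timed (\<lambda>(s, s'). scan X (f s s')) (qs X)))"
  unfolding snd_map_scan by (intro poly_bounded_intros assms)

lemma poly_bounded_linear_steps: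
  assumes "poly_in_input (\<lambda>X. length (xs X))"
  shows "poly_in_input (\<lambda>X. snd (map_timed (\<lambda>x. scan X (f x)) (xs X)))"
    and "poly_in_input (\<lambda>X. snd (map_timed (\<lambda>x. charge 1 (g x)) (map (h X) (xs X))))"
    and "poly_in_input (\<lambda>X. snd (append_timed (map k (xs X)) (ys X)))"
  unfolding snd_map_scan snd_map_charge append_timed_simps length_map
  by (intro poly_bounded_intros assms)+

lemma flow_list_size_flow_table:
  "flow_list_size (map snd (flow_table mcc X)) \<le> flow_list_size (fst (mcc (split_network X)))"
proof -
  have "flow_list_size (map snd (zip xs ks)) \<le> flow_list_size ks" for xs :: "'x list" and ks
    by (induction xs ks rule: list_induct2') auto
  then show ?thesis by (simp add: flow_table_def)
qed

text \<open>The solver sees a network of polynomial size, so its running time is polynomial. As this time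
  covers the writing of its output, the length of the flow is polynomial too, which bounds the
  recombination.\<close>

lemma poly_bounded_edge_decomposition:
  assumes mcc: "polynomial_time (\<lambda>N. valid_network N \<and> rational_network N)
    network_size flow_list_size mcc"
  shows "poly_in_input (\<lambda>X. snd (edge_decomposition mcc X))"
proof -
  obtain p where p: "flow_list_size (fst (mcc N)) \<le> snd (mcc N)" "snd (mcc N) \<le> poly p (network_size N)"
    if "valid_network N" "rational_network N" for N
    using mcc by (auto simp: polynomial_time_def)
  have size: "poly_in_input (\<lambda>X. network_size (split_network X))"
    by (rule poly_bounded_mono[OF _ network_size_split_network_le])
      (intro poly_bounded_intros poly_bounded_lengths)
  have solver: "poly_in_input (\<lambda>X. snd (mcc (split_network X)))"
    by (rule poly_bounded_mono[OF poly_bounded_poly[OF size, of p]])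
      (simp add: p valid_split_network rational_split_network)
  have flow: "poly_in_input (\<lambda>X. flow_list_size (fst (mcc (split_network X))))"
    by (rule poly_bounded_mono[OF solver]) (simp add: p valid_split_network rational_split_network)
  have zip: "poly_in_input (\<lambda>X. snd (zip_timed (split_edges X) (fst (mcc (split_network X)))))"
    by (rule poly_bounded_mono[OF poly_bounded_Suc[OF poly_bounded_lengths(7)]]) simp
  have units: "poly_in_input (\<lambda>X. snd (map_timed (decomposed_arcs X) (admissible_list X)))"
  proof (rule poly_bounded_map_timed[where c = "\<lambda>X. decomposed_arcs_time (input_size X)"])
    show "poly_in_input (\<lambda>X. decomposed_arcs_time (input_size X))"
      unfolding decomposed_arcs_time_def unit_arc_time_def by (intro poly_bounded_intros)
  qed (simp_all add: poly_bounded_lengths snd_decomposed_arcs_le)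
  have kept: "poly_in_input (\<lambda>X. snd (map_timed (kept_arc X) (linear_edges X)))"
    by (rule poly_bounded_map_timed[where c = "\<lambda>X. Suc (input_size X)"])
      (simp_all add: kept_arc_def poly_bounded_lengths poly_bounded_Suc poly_bounded_size)
  have concat: "poly_in_input (\<lambda>X. snd (concat_timed
      (fst (map_timed (decomposed_arcs X) (admissible_list X)))))"
    by (simp add: concat_decomposed_arcs) (intro poly_bounded_intros poly_bounded_lengths)
  have linear: "poly_in_input (\<lambda>X. snd (concat_timed [[E_OI], map E_I (state_list X),
      map E_O (state_list X), map (case_prod E_o) (admissible_list X)]))"
    by simp (intro poly_bounded_intros poly_bounded_lengths)
  have append: "poly_in_input (\<lambda>X. snd (append_timed
      (fst (concat_timed (fst (map_timed (decomposed_arcs X) (admissible_list X)))))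
      (fst (map_timed (kept_arc X) (linear_edges X)))))"
    by (simp add: concat_decomposed_arcs) (intro poly_bounded_intros poly_bounded_lengths)
  have collect: "poly_in_input (\<lambda>X. snd (map_timed (recombine X (flow_table mcc X)) (all_edges X)))"
  proof (rule poly_bounded_map_timed)
    let ?c = "\<lambda>X. recombine_time (input_size X) (flow_list_size (fst (mcc (split_network X))))"
    show "poly_in_input ?c"
      unfolding recombine_time_def by (intro poly_bounded_intros flow)
    show "snd (recombine X (flow_table mcc X) e) \<le> ?c X" for X e
      by (rule recombine_cost(2)[OF flow_list_size_flow_table])
  qed (rule poly_bounded_lengths)
  show ?thesis
    unfolding edge_decomposition_steps
    by (intro poly_bounded_add poly_bounded_list_states poly_bounded_list_admissible units kept concat
        append solver zip collect linear poly_bounded_map_scan_pairs poly_bounded_linear_steps poly_bounded_lengths)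
qed

text \<open>Already the last step is charged for every number it outputs.\<close>

lemma output_size_le_time:
  "flow_list_size (map snd (fst (edge_decomposition mcc X))) \<le> snd (edge_decomposition mcc X)"
proof -
  have "flow_list_size (map snd (map (\<lambda>e. fst (f e)) es)) \<le> snd (map_timed f es)"
    if "\<And>e. nat_bits (snd (fst (f e))) \<le> snd (f e)" for f :: "'x \<Rightarrow> ('x \<times> nat) timed" and es
    using that by (induction es) (auto intro: add_mono le_SucI)
  from this[OF recombine_cost(3)[OF order_refl]]
  have "flow_list_size (map snd (fst (map_timed (recombine X (flow_table mcc X)) (all_edges X))))
      \<le> snd (map_timed (recombine X (flow_table mcc X)) (all_edges X))"
    unfolding fst_map_timed .
  then show ?thesis
    unfolding edge_decomposition_steps by simp
qed

section \<open>The returned flow\<close>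

lemma fst_recombine_flow_table:
  assumes "valid_dispatch X" "length (fst (mcc (split_network X))) = length (split_edges X)"
  shows "fst (recombine X (flow_table mcc X) e) = (e, split.merge X (flow_of (flow_table mcc X)) e)"
proof -
  let ?xs = "split_edges X" and ?g = "flow_of (flow_table mcc X)"
  have tab: "flow_table mcc X = map (\<lambda>x. (x, ?g x)) ?xs"
    by (rule nth_equalityI)
      (use assms flow_of_zip[OF distinct_split_edges[OF assms(1)] assms(2)] in \<open>auto simp: flow_table_def\<close>)
  have sums: "(\<Sum>(x, k)\<leftarrow>filter (\<lambda>(x, k). P x) (map (\<lambda>x. (x, h x)) xs). k) = (\<Sum>x\<leftarrow>filter P xs. h x)"
    for P and h :: "'a split_edge \<Rightarrow> nat" and xs
    by (induction xs) auto
  have "(\<Sum>(x, k)\<leftarrow>filter (\<lambda>(x, k). origin x = e) (flow_table mcc X). k)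
      = (\<Sum>x\<leftarrow>filter (\<lambda>x. origin x = e) ?xs. ?g x)"
    by (subst tab) (rule sums)
  also have "\<dots> = split.merge X ?g e"
    using distinct_split_edges[OF assms(1)]
    by (simp add: split.merge_def split.fibre_def sum_list_distinct_conv_sum_set)
  finally show ?thesis by (simp add: recombine_cost(1)[OF order_refl])
qed

lemma set_all_edges: "set (all_edges X) = arcs (dispatch_graph X)"
  by (auto simp: all_edges_def set_linear_edges arcs_dispatch_graph)

text \<open>The returned table says nothing about edges outside the graph, where \<open>flow_of\<close> is 0 by default.\<close>

lemma max_revenue_flow_cong:
  assumes "max_revenue_flow X f" "\<And>e. e \<in> arcs (dispatch_graph X) \<Longrightarrow> f e = g e"
  shows "max_revenue_flow X g"
proof -
  have "(\<Sum>e\<in>in_arcs (dispatch_graph X) v. f e) = (\<Sum>e\<in>in_arcs (dispatch_graph X) v. g e)"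
    "(\<Sum>e\<in>out_arcs (dispatch_graph X) v. f e) = (\<Sum>e\<in>out_arcs (dispatch_graph X) v. g e)" for v
    using assms(2) by (auto intro: sum.cong)
  moreover have "(\<Sum>e\<in>arcs (dispatch_graph X). reward X (f e) e) = (\<Sum>e\<in>arcs (dispatch_graph X). reward X (g e) e)"
    using assms(2) by (auto intro: sum.cong)
  ultimately show ?thesis
    using assms unfolding max_revenue_flow_def nlwc_optimal_def circulation_def by simp
qed

theorem theorem2:
  fixes mcc :: "'l vertex network \<Rightarrow> nat list timed"
  assumes "solves_min_cost_circulation mcc"
    and "polynomial_time (\<lambda>N. valid_network N \<and> rational_network N)
           network_size flow_list_size mcc"
  shows "polynomial_time (\<lambda>X. valid_dispatch X \<and> rational_dispatch X)
           input_size (\<lambda>tab. flow_list_size (map snd tab)) (edge_decomposition mcc)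
       \<and> (\<forall>X. valid_dispatch X \<and> regular X \<longrightarrow>
            max_revenue_flow X (flow_of (fst (edge_decomposition mcc X))))"
proof (intro conjI allI impI)
  show "polynomial_time (\<lambda>X. valid_dispatch X \<and> rational_dispatch X)
      input_size (\<lambda>tab. flow_list_size (map snd tab)) (edge_decomposition mcc)"
    using poly_bounded_edge_decomposition[OF assms(2)] output_size_le_time
    unfolding polynomial_time_def poly_bounded_def by blast
next
  fix X :: "'l dispatch" assume X: "valid_dispatch X \<and> regular X"
  then have len: "length (fst (mcc (split_network X))) = length (split_edges X)"
    and opt: "max_revenue_flow X (split.merge X (flow_of (flow_table mcc X)))"
    using max_revenue_of_solver[OF assms(1)] by (auto simp: flow_table_def)
  have "fst (edge_decomposition mcc X)
      = map (\<lambda>e. (e, split.merge X (flow_of (flow_table mcc X)) e)) (all_edges X)"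
    using X len by (simp add: fst_edge_decomposition fst_recombine_flow_table)
  then show "max_revenue_flow X (flow_of (fst (edge_decomposition mcc X)))"
    using flow_of_graph[of _ "all_edges X"]
    by (intro max_revenue_flow_cong[OF opt]) (simp add: set_all_edges)
qed

end
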